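(* Let $i:B\to S$ be a ring homomorphism such that the functor $-\otimes_BS:\mathrm{Mod}_B\to\mathrm{Mod}_S$ is comonadic. Then $\Gamma':I^r_B(S)\to\mathrm{End}_{\mathrm{cor}}(S\otimes_BS)$ is an anti-isomorphism of monoids.
   Context: $S$ is a $B$-bimodule via $i$. Sweedler coring $S\otimes_BS$: $S$-bimodule with comultiplication $s\otimes s'\mapsto s\otimes1\otimes s'$, counit $s\otimes s'\mapsto ss'$; $\mathrm{End}_{\mathrm{cor}}(S\otimes_BS)$ is the monoid under composition of $S$-bimodule endomorphisms compatible with comultiplication and counit. A right $S\otimes_BS$-comodule is $(Y,\theta_Y)$ with $Y$ a right $S$-module, $\theta_Y:Y\to Y\otimes_BS$ right $S$-linear, with $(y\otimes s\mapsto ys)\circ\theta_Y=\mathrm{id}$ and $(\theta_Y\otimes_BS)\theta_Y=(\eta'_Y\otimes_BS)\theta_Y$, where $\eta'_Y(y)=y\otimes_B1$. $-\otimes_BS$ is comonadic if the comparison functor $X\mapsto(X\otimes_BS,\eta'_X\otimes_BS)$ from $\mathrm{Mod}_B$ to right $S\otimes_BS$-comodules is an equivalence. $I_B(S)$: monoid of $B$-subbimodules of $S$ with product $IJ=\{\sum_kx_ky_k\}$. $I^r_B(S)$: submonoid of those $I$ with $\mathbf m^r_I:I\otimes_BS\to S$, $x\otimes s\mapsto xs$, an isomorphism. $\Gamma'(I)=(\nu_I\otimes_BS)\circ(S\otimes_B(\mathbf m^r_I)^{-1}):S\otimes_BS\to S\otimes_BI\otimes_BS\to S\otimes_BS$,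 where $\nu_I:S\otimes_BI\to S$ is multiplication. *)

theory Defs
  imports Main "HOL-Library.FuncSet"
begin

record 'a abg =
  carr  :: "'a set"
  addg  :: "'a \<Rightarrow> 'a \<Rightarrow> 'a"
  zerog :: 'a

text \<open>An \<open>('l,'r)\<close>-bimodule structure: left action by ring \<open>'l\<close>, right action by ring \<open>'r\<close>.
  Right modules simply ignore the field \<open>lact\<close>.\<close>
record ('a,'l,'r) bimod = "'a abg" +
  lact :: "'l \<Rightarrow> 'a \<Rightarrow> 'a"
  ract :: "'a \<Rightarrow> 'r \<Rightarrow> 'a"

definition abelian_grp :: "('a,'m) abg_scheme \<Rightarrow> bool" where
  "abelian_grp G \<longleftrightarrow>
     zerog G \<in> carr G \<and>
     (\<forall>x\<in>carr G. \<forall>y\<in>carr G. addg G x y \<in> carr G) \<and>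
     (\<forall>x\<in>carr G. \<forall>y\<in>carr G. \<forall>z\<in>carr G. addg G (addg G x y) z = addg G x (addg G y z)) \<and>
     (\<forall>x\<in>carr G. \<forall>y\<in>carr G. addg G x y = addg G y x) \<and>
     (\<forall>x\<in>carr G. addg G (zerog G) x = x) \<and>
     (\<forall>x\<in>carr G. \<exists>y\<in>carr G. addg G x y = zerog G)"

definition right_mod :: "('a,'l,'r::ring_1,'m) bimod_scheme \<Rightarrow> bool" where
  "right_mod M \<longleftrightarrow> abelian_grp M \<and>
     (\<forall>x\<in>carr M. \<forall>r. ract M x r \<in> carr M) \<and>
     (\<forall>x\<in>carr M. \<forall>y\<in>carr M. \<forall>r. ract M (addg M x y) r = addg M (ract M x r) (ract M y r)) \<and>
     (\<forall>x\<in>carr M. \<forall>r s. ract M x (r + s) = addg M (ract M x r) (ract M x s)) \<and>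
     (\<forall>x\<in>carr M. \<forall>r s. ract M x (r * s) = ract M (ract M x r) s) \<and>
     (\<forall>x\<in>carr M. ract M x 1 = x)"

definition left_mod :: "('a,'l::ring_1,'r,'m) bimod_scheme \<Rightarrow> bool" where
  "left_mod M \<longleftrightarrow> abelian_grp M \<and>
     (\<forall>x\<in>carr M. \<forall>l. lact M l x \<in> carr M) \<and>
     (\<forall>x\<in>carr M. \<forall>y\<in>carr M. \<forall>l. lact M l (addg M x y) = addg M (lact M l x) (lact M l y)) \<and>
     (\<forall>x\<in>carr M. \<forall>l k. lact M (l + k) x = addg M (lact M l x) (lact M k x)) \<and>
     (\<forall>x\<in>carr M. \<forall>l k. lact M (l * k) x = lact M l (lact M k x)) \<and>
     (\<forall>x\<in>carr M. lact M 1 x = x)"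

definition ab_hom :: "('a,'m) abg_scheme \<Rightarrow> ('b,'n) abg_scheme \<Rightarrow> ('a \<Rightarrow> 'b) \<Rightarrow> bool" where
  "ab_hom M N f \<longleftrightarrow> f \<in> carr M \<rightarrow> carr N \<and>
     (\<forall>x\<in>carr M. \<forall>y\<in>carr M. f (addg M x y) = addg N (f x) (f y))"

definition right_hom :: "('a,'l,'r,'m) bimod_scheme \<Rightarrow> ('b,'k,'r,'n) bimod_scheme \<Rightarrow> ('a \<Rightarrow> 'b) \<Rightarrow> bool" where
  "right_hom M N f \<longleftrightarrow> ab_hom M N f \<and> (\<forall>x\<in>carr M. \<forall>r. f (ract M x r) = ract N (f x) r)"

definition left_hom :: "('a,'l,'r,'m) bimod_scheme \<Rightarrow> ('b,'l,'t,'n) bimod_scheme \<Rightarrow> ('a \<Rightarrow> 'b) \<Rightarrow> bool" where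
  "left_hom M N f \<longleftrightarrow> ab_hom M N f \<and> (\<forall>x\<in>carr M. \<forall>l. f (lact M l x) = lact N l (f x))"

definition rhoms :: "('a,'l,'r,'m) bimod_scheme \<Rightarrow> ('b,'k,'r,'n) bimod_scheme \<Rightarrow> ('a \<Rightarrow> 'b) set" where
  "rhoms M N = {f. right_hom M N f \<and> f \<in> extensional (carr M)}"

text \<open>Constructed as the free abelian group on \<open>carr M \<times> carr N\<close> (finitely supported
  integer-valued functions) modulo the subgroup generated by the bilinearity and balancing
  relations; elements are the cosets.\<close>

definition fsupp :: "('p \<Rightarrow> int) \<Rightarrow> 'p set" where
  "fsupp f = {p. f p \<noteq> 0}"

definition fsums :: "('m,'l,'r,'x) bimod_scheme \<Rightarrow> ('n,'r,'t,'y) bimod_scheme \<Rightarrow> ('m \<times> 'n \<Rightarrow> int) set" where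
  "fsums M N = {f. finite (fsupp f) \<and> fsupp f \<subseteq> carr M \<times> carr N}"

definition delta :: "'p \<Rightarrow> 'p \<Rightarrow> int" where
  "delta p = (\<lambda>q. if q = p then 1 else 0)"

inductive_set trel :: "('m,'l,'r,'x) bimod_scheme \<Rightarrow> ('n,'r,'t,'y) bimod_scheme \<Rightarrow> ('m \<times> 'n \<Rightarrow> int) set"
  for M N where
  add_left: "\<lbrakk>x \<in> carr M; x' \<in> carr M; y \<in> carr N\<rbrakk> \<Longrightarrow>
     (\<lambda>q. delta (addg M x x', y) q - delta (x, y) q - delta (x', y) q) \<in> trel M N"
| add_right: "\<lbrakk>x \<in> carr M; y \<in> carr N; y' \<in> carr N\<rbrakk> \<Longrightarrow>
     (\<lambda>q. delta (x, addg N y y') q - delta (x, y) q - delta (x, y') q) \<in> trel M N"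
| balanced: "\<lbrakk>x \<in> carr M; y \<in> carr N\<rbrakk> \<Longrightarrow>
     (\<lambda>q. delta (ract M x r, y) q - delta (x, lact N r y) q) \<in> trel M N"
| zero: "(\<lambda>q. 0) \<in> trel M N"
| diff: "\<lbrakk>f \<in> trel M N; g \<in> trel M N\<rbrakk> \<Longrightarrow> (\<lambda>q. f q - g q) \<in> trel M N"

definition tclass :: "('m,'l,'r,'x) bimod_scheme \<Rightarrow> ('n,'r,'t,'y) bimod_scheme \<Rightarrow> ('m \<times> 'n \<Rightarrow> int) \<Rightarrow> ('m \<times> 'n \<Rightarrow> int) set" where
  "tclass M N f = {g \<in> fsums M N. (\<lambda>q. f q - g q) \<in> trel M N}"

definition trep :: "('p \<Rightarrow> int) set \<Rightarrow> 'p \<Rightarrow> int" where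
  "trep A = (SOME f. f \<in> A)"

definition push :: "('p \<Rightarrow> 'q) \<Rightarrow> ('p \<Rightarrow> int) \<Rightarrow> 'q \<Rightarrow> int" where
  "push \<phi> f = (\<lambda>q. \<Sum>p\<in>{p \<in> fsupp f. \<phi> p = q}. f p)"

definition tensor :: "('m,'l,'r,'x) bimod_scheme \<Rightarrow> ('n,'r,'t,'y) bimod_scheme \<Rightarrow> (('m \<times> 'n \<Rightarrow> int) set, 'l, 't) bimod" where
  "tensor M N = \<lparr> carr = tclass M N ` fsums M N,
     addg = (\<lambda>A B. tclass M N (\<lambda>q. trep A q + trep B q)),
     zerog = tclass M N (\<lambda>q. 0),
     lact = (\<lambda>l A. tclass M N (push (\<lambda>(x, y). (lact M l x, y)) (trep A))),
     ract = (\<lambda>A t. tclass M N (push (\<lambda>(x, y). (x, ract N y t)) (trep A))) \<rparr>"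

definition tens :: "('m,'l,'r,'x) bimod_scheme \<Rightarrow> ('n,'r,'t,'y) bimod_scheme \<Rightarrow> 'm \<Rightarrow> 'n \<Rightarrow> ('m \<times> 'n \<Rightarrow> int) set" where
  "tens M N x y = tclass M N (delta (x, y))"

definition tinduce :: "('m,'l,'r,'x) bimod_scheme \<Rightarrow> ('n,'r,'t,'y) bimod_scheme \<Rightarrow>
    ('m2,'l2,'r2,'x2) bimod_scheme \<Rightarrow> ('n2,'r2,'t2,'y2) bimod_scheme \<Rightarrow>
    ('m \<times> 'n \<Rightarrow> 'm2 \<times> 'n2) \<Rightarrow> ('m \<times> 'n \<Rightarrow> int) set \<Rightarrow> ('m2 \<times> 'n2 \<Rightarrow> int) set" where
  "tinduce M N M' N' \<phi> A =
     (if A \<in> carr (tensor M N) then tclass M' N' (push \<phi> (trep A)) else undefined)"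

definition tmap :: "('m,'l,'r,'x) bimod_scheme \<Rightarrow> ('n,'r,'t,'y) bimod_scheme \<Rightarrow>
    ('m2,'l2,'r2,'x2) bimod_scheme \<Rightarrow> ('n2,'r2,'t2,'y2) bimod_scheme \<Rightarrow>
    ('m \<Rightarrow> 'm2) \<Rightarrow> ('n \<Rightarrow> 'n2) \<Rightarrow> ('m \<times> 'n \<Rightarrow> int) set \<Rightarrow> ('m2 \<times> 'n2 \<Rightarrow> int) set" where
  "tmap M N M' N' f g = tinduce M N M' N' (\<lambda>(x, y). (f x, g y))"

text \<open>The additive map \<open>M \<otimes> N \<rightarrow> P\<close> determined by \<open>x \<otimes> y \<mapsto> h x y\<close> (for balanced biadditive \<open>h\<close>).\<close>
definition tlift :: "('m,'l,'r,'x) bimod_scheme \<Rightarrow> ('n,'r,'t,'y) bimod_scheme \<Rightarrow> ('p,'z) abg_scheme \<Rightarrow>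
    ('m \<Rightarrow> 'n \<Rightarrow> 'p) \<Rightarrow> ('m \<times> 'n \<Rightarrow> int) set \<Rightarrow> 'p" where
  "tlift M N P h = (THE F. F \<in> extensional (carr (tensor M N)) \<and> ab_hom (tensor M N) P F \<and>
       (\<forall>x\<in>carr M. \<forall>y\<in>carr N. F (tens M N x y) = h x y))"

definition ring_hom' :: "('b::ring_1 \<Rightarrow> 's::ring_1) \<Rightarrow> bool" where
  "ring_hom' i \<longleftrightarrow> i 1 = 1 \<and> (\<forall>a b. i (a + b) = i a + i b) \<and> (\<forall>a b. i (a * b) = i a * i b)"

definition S_SS :: "('s::ring_1, 's, 's) bimod" where
  "S_SS = \<lparr> carr = UNIV, addg = (+), zerog = 0, lact = (*), ract = (*) \<rparr>"

definition S_BS :: "('b \<Rightarrow> 's::ring_1) \<Rightarrow> ('s, 'b, 's) bimod" where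
  "S_BS i = \<lparr> carr = UNIV, addg = (+), zerog = 0, lact = (\<lambda>b s. i b * s), ract = (*) \<rparr>"

definition S_SB :: "('b \<Rightarrow> 's::ring_1) \<Rightarrow> ('s, 's, 'b) bimod" where
  "S_SB i = \<lparr> carr = UNIV, addg = (+), zerog = 0, lact = (*), ract = (\<lambda>s b. s * i b) \<rparr>"

definition sub_BB :: "('b \<Rightarrow> 's::ring_1) \<Rightarrow> 's set \<Rightarrow> ('s, 'b, 'b) bimod" where
  "sub_BB i I = \<lparr> carr = I, addg = (+), zerog = 0, lact = (\<lambda>b s. i b * s), ract = (\<lambda>s b. s * i b) \<rparr>"

definition restr :: "('b \<Rightarrow> 's) \<Rightarrow> ('a, 'l, 's) bimod \<Rightarrow> ('a, 'l, 'b) bimod" where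
  "restr i M = \<lparr> carr = carr M, addg = addg M, zerog = zerog M, lact = lact M,
                 ract = (\<lambda>x b. ract M x (i b)) \<rparr>"

definition sweedler :: "('b \<Rightarrow> 's::ring_1) \<Rightarrow> (('s \<times> 's \<Rightarrow> int) set, 's, 's) bimod" where
  "sweedler i = tensor (S_SB i) (S_BS i)"

definition comult :: "('b \<Rightarrow> 's::ring_1) \<Rightarrow> ('s \<times> 's \<Rightarrow> int) set \<Rightarrow>
    (('s \<times> 's \<Rightarrow> int) set \<times> ('s \<times> 's \<Rightarrow> int) set \<Rightarrow> int) set" where
  "comult i = tinduce (S_SB i) (S_BS i) (sweedler i) (sweedler i)
      (\<lambda>(s, s'). (tens (S_SB i) (S_BS i) s 1, tens (S_SB i) (S_BS i) 1 s'))"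

definition counit :: "('b \<Rightarrow> 's::ring_1) \<Rightarrow> ('s \<times> 's \<Rightarrow> int) set \<Rightarrow> 's" where
  "counit i = tlift (S_SB i) (S_BS i) (S_SS :: ('s,'s,'s) bimod) (\<lambda>s s'. s * s')"

definition End_cor :: "('b \<Rightarrow> 's::ring_1) \<Rightarrow> (('s \<times> 's \<Rightarrow> int) set \<Rightarrow> ('s \<times> 's \<Rightarrow> int) set) set" where
  "End_cor i = {g. g \<in> extensional (carr (sweedler i)) \<and>
      left_hom (sweedler i) (sweedler i) g \<and> right_hom (sweedler i) (sweedler i) g \<and>
      (\<forall>A\<in>carr (sweedler i).
         comult i (g A) = tmap (sweedler i) (sweedler i) (sweedler i) (sweedler i) g g (comult i A)) \<and>
      (\<forall>A\<in>carr (sweedler i). counit i (g A) = counit i A)}"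

definition subbimods :: "('b \<Rightarrow> 's::ring_1) \<Rightarrow> 's set set" where
  "subbimods i = {I. 0 \<in> I \<and> (\<forall>x\<in>I. \<forall>y\<in>I. x + y \<in> I) \<and> (\<forall>x\<in>I. - x \<in> I) \<and>
                     (\<forall>x\<in>I. \<forall>b. i b * x \<in> I \<and> x * i b \<in> I)}"

definition subprod :: "'s::ring_1 set \<Rightarrow> 's set \<Rightarrow> 's set" where
  "subprod I J = {z. \<exists>xs ys. length xs = length ys \<and> set xs \<subseteq> I \<and> set ys \<subseteq> J \<and>
                        z = sum_list (map2 (*) xs ys)}"

definition mr :: "('b \<Rightarrow> 's::ring_1) \<Rightarrow> 's set \<Rightarrow> ('s \<times> 's \<Rightarrow> int) set \<Rightarrow> 's" where
  "mr i I = tlift (sub_BB i I) (S_BS i) (S_SS :: ('s,'s,'s) bimod) (\<lambda>x s. x * s)"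

definition Ir :: "('b \<Rightarrow> 's::ring_1) \<Rightarrow> 's set set" where
  "Ir i = {I \<in> subbimods i. right_hom (tensor (sub_BB i I) (S_BS i)) (S_SS :: ('s,'s,'s) bimod) (mr i I) \<and>
                            bij_betw (mr i I) (carr (tensor (sub_BB i I) (S_BS i))) UNIV}"

text \<open>\<open>\<Gamma>'(I) = (\<nu>_I \<otimes>_B S) \<circ> (S \<otimes>_B (m^r_I)^{-1})\<close>, written on generators:
  \<open>s \<otimes> s' \<mapsto> (\<nu>_I \<otimes> S)(s \<otimes> (m^r_I)^{-1}(s')) = ((x \<mapsto> s x) \<otimes> S)((m^r_I)^{-1}(s'))\<close>.\<close>
definition Gamma' :: "('b \<Rightarrow> 's::ring_1) \<Rightarrow> 's set \<Rightarrow> ('s \<times> 's \<Rightarrow> int) set \<Rightarrow> ('s \<times> 's \<Rightarrow> int) set" where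
  "Gamma' i I = tlift (S_SB i) (S_BS i) (sweedler i)
      (\<lambda>s s'. tmap (sub_BB i I) (S_BS i) (S_SB i) (S_BS i) (\<lambda>x. s * x) id
                (the_inv_into (carr (tensor (sub_BB i I) (S_BS i))) (mr i I) s'))"

definition eta' :: "('b \<Rightarrow> 's::ring_1) \<Rightarrow> ('a, 'l, 'b) bimod \<Rightarrow> 'a \<Rightarrow> ('a \<times> 's \<Rightarrow> int) set" where
  "eta' i Y y = tens Y (S_BS i) y 1"

definition is_comodule :: "('b \<Rightarrow> 's::ring_1) \<Rightarrow> ('a, 'l, 's) bimod \<Rightarrow> ('a \<Rightarrow> ('a \<times> 's \<Rightarrow> int) set) \<Rightarrow> bool" where
  "is_comodule i Y \<theta> \<longleftrightarrow> right_mod Y \<and> \<theta> \<in> extensional (carr Y) \<and>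
     right_hom Y (tensor (restr i Y) (S_BS i)) \<theta> \<and>
     (\<forall>y\<in>carr Y. tlift (restr i Y) (S_BS i) Y (\<lambda>z s. ract Y z s) (\<theta> y) = y) \<and>
     (\<forall>y\<in>carr Y.
        tmap (restr i Y) (S_BS i) (restr i (tensor (restr i Y) (S_BS i))) (S_BS i) \<theta> id (\<theta> y) =
        tmap (restr i Y) (S_BS i) (restr i (tensor (restr i Y) (S_BS i))) (S_BS i) (eta' i (restr i Y)) id (\<theta> y))"

definition comod_hom :: "('b \<Rightarrow> 's::ring_1) \<Rightarrow> ('a, 'l, 's) bimod \<Rightarrow> ('a \<Rightarrow> ('a \<times> 's \<Rightarrow> int) set) \<Rightarrow>
    ('c, 'k, 's) bimod \<Rightarrow> ('c \<Rightarrow> ('c \<times> 's \<Rightarrow> int) set) \<Rightarrow> ('a \<Rightarrow> 'c) \<Rightarrow> bool" where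
  "comod_hom i Y \<theta> Y' \<theta>' f \<longleftrightarrow> right_hom Y Y' f \<and> f \<in> extensional (carr Y) \<and>
     (\<forall>y\<in>carr Y. \<theta>' (f y) = tmap (restr i Y) (S_BS i) (restr i Y') (S_BS i) f id (\<theta> y))"

text \<open>The comparison functor \<open>X \<mapsto> (X \<otimes>_B S, \<eta>'_X \<otimes>_B S)\<close>.\<close>
definition Kobj :: "('b \<Rightarrow> 's::ring_1) \<Rightarrow> ('a, 'l, 'b) bimod \<Rightarrow> (('a \<times> 's \<Rightarrow> int) set, 'l, 's) bimod" where
  "Kobj i X = tensor X (S_BS i)"

definition Kcoact :: "('b \<Rightarrow> 's::ring_1) \<Rightarrow> ('a, 'l, 'b) bimod \<Rightarrow>
    ('a \<times> 's \<Rightarrow> int) set \<Rightarrow> (('a \<times> 's \<Rightarrow> int) set \<times> 's \<Rightarrow> int) set" where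
  "Kcoact i X = tmap X (S_BS i) (restr i (Kobj i X)) (S_BS i) (eta' i X) id"

definition Kmor :: "('b \<Rightarrow> 's::ring_1) \<Rightarrow> ('a, 'l, 'b) bimod \<Rightarrow> ('c, 'k, 'b) bimod \<Rightarrow> ('a \<Rightarrow> 'c) \<Rightarrow>
    ('a \<times> 's \<Rightarrow> int) set \<Rightarrow> ('c \<times> 's \<Rightarrow> int) set" where
  "Kmor i X X' f = tmap X (S_BS i) X' (S_BS i) f id"

type_synonym ('b, 's) univ = "('b \<times> 's) list set"

definition comonadic :: "('b::ring_1 \<Rightarrow> 's::ring_1) \<Rightarrow> bool" where
  "comonadic i \<longleftrightarrow>
     (\<forall>(X :: (('b,'s) univ, unit, 'b) bimod) (X' :: (('b,'s) univ, unit, 'b) bimod).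
        right_mod X \<longrightarrow> right_mod X' \<longrightarrow>
        bij_betw (Kmor i X X') (rhoms X X')
          {f. comod_hom i (Kobj i X) (Kcoact i X) (Kobj i X') (Kcoact i X') f}) \<and>
     (\<forall>(Y :: (('b,'s) univ, unit, 's) bimod) \<theta>. is_comodule i Y \<theta> \<longrightarrow>
        (\<exists>X :: (('b,'s) univ, unit, 'b) bimod. right_mod X \<and>
           (\<exists>f. comod_hom i (Kobj i X) (Kcoact i X) Y \<theta> f \<and> bij_betw f (carr (Kobj i X)) (carr Y))))"

end

theory Submission
  imports Defs "HOL-Algebra.FiniteProduct"
begin

text \<open>For \<open>I\<close> in \<open>I\<^sup>r\<^sub>B(S)\<close> the map \<open>\<Gamma>'(I)\<close> is the only \<open>S\<close>-bimodule endomorphism of \<open>S \<otimes>\<^sub>B S\<close> with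
  \<open>1 \<otimes> x \<mapsto> x \<otimes> 1\<close> for all \<open>x \<in> I\<close>, because \<open>I S = S\<close>; this characterisation yields compatibility with the
  coring structure, the (reversed) product and the unit. The inverse map is \<open>g \<mapsto> {s. g(1 \<otimes> s) = s \<otimes> 1}\<close>.
  Indeed an endomorphism \<open>g\<close> of the coring makes \<open>S\<close> a comodule by \<open>s \<mapsto> g(1 \<otimes> s)\<close>, and this set consists of its
  coinvariants. Comonadicity, applied to maps out of the regular module \<open>B\<close>, identifies every \<open>X\<close> with the
  coinvariants of \<open>X \<otimes>\<^sub>B S\<close>. For \<open>X = I\<close> this recovers \<open>I\<close> from \<open>\<Gamma>'(I)\<close>; for the \<open>X\<close> with \<open>X \<otimes>\<^sub>B S \<cong> S\<close> as comodules
  it shows that the coinvariants of \<open>S\<close> lie in \<open>I\<^sup>r\<^sub>B(S)\<close>.\<close>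

text \<open>Two obstacles shape the proof. First, \<open>comonadic\<close> quantifies over modules
  with elements in the single type \<open>univ\<close>, since a definition in HOL cannot quantify
  over types. The modules fed to it are the rings \<open>B\<close> and \<open>S\<close> and a
  subbimodule \<open>I\<close>, so each is transported along an injection into \<open>univ\<close>
  and the conclusions are carried back. Second, \<open>S\<close> is not assumed flat over
  \<open>B\<close>, so \<open>I \<otimes> S\<close> is not known to embed in
  \<open>S \<otimes> S\<close>. The equation saying that \<open>Gamma' i I\<close> sends
  \<open>1 \<otimes> x\<close> to \<open>x \<otimes> 1\<close> lives in \<open>S \<otimes> S\<close>
  and cannot simply be pulled back to \<open>I \<otimes> S\<close>. It is pushed forward into
  \<open>(I \<otimes> S) \<otimes> S\<close> instead, where it says that the preimage of
  \<open>x\<close> under \<open>mr i I\<close> is coinvariant. Tensor products are sets of cosets in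
  a free abelian group, with operations defined through chosen representatives. Once the universal
  property is available, maps are built from balanced maps and compared on pure tensors
  only.\<close>

section \<open>Free sums and integer combinations in an abelian group\<close>

text \<open>Recasts an additive group as a multiplicative record of HOL-Algebra, which gives access
  to \<open>finprod\<close> and to integer powers.\<close>

definition grp :: "('a,'m) abg_scheme \<Rightarrow> 'a monoid" where
  "grp P = \<lparr>carrier = carr P, monoid.mult = addg P, one = zerog P\<rparr>"

lemma grp_simps [simp]:
  "carrier (grp P) = carr P" "monoid.mult (grp P) = addg P" "one (grp P) = zerog P"
  by (simp_all add: grp_def)

lemma comm_group_grp:
  assumes "abelian_grp P"
  shows "comm_group (grp P)"
proof (rule comm_groupI)
  show "\<exists>y\<in>carrier (grp P). y \<otimes>\<^bsub>grp P\<^esub> x = \<one>\<^bsub>grp P\<^esub>" if "x \<in> carrier (grp P)" for x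
    using that assms unfolding abelian_grp_def by simp metis
qed (use assms in \<open>auto simp: abelian_grp_def\<close>)

text \<open>In additive notation this is the integer combination of the values \<open>h p\<close>
  with coefficients \<open>f p\<close>: the homomorphism out of the free abelian group that extends
  \<open>h\<close>.\<close>

definition ev :: "('p,'z) abg_scheme \<Rightarrow> ('q \<Rightarrow> 'p) \<Rightarrow> ('q \<Rightarrow> int) \<Rightarrow> 'p" where
  "ev P h f = finprod (grp P) (\<lambda>p. h p [^]\<^bsub>grp P\<^esub> f p) (fsupp f)"

lemma grp_pow_closed:
  assumes "abelian_grp P" and "x \<in> carr P"
  shows "x [^]\<^bsub>grp P\<^esub> (n::int) \<in> carr P"
  using group.int_pow_closed[OF comm_group.axioms(2)[OF comm_group_grp[OF assms(1)]], of x n] assms(2)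
  by simp

text \<open>Outside the support the exponent is 0. Two combinations can therefore be taken over one
  common finite set, which is what additivity needs.\<close>

lemma ev_cong_support:
  assumes P: "abelian_grp P" and "finite A" "fsupp f \<subseteq> A" "h \<in> A \<rightarrow> carr P"
  shows "ev P h f = finprod (grp P) (\<lambda>p. h p [^]\<^bsub>grp P\<^esub> f p) A"
proof -
  interpret comm_group "grp P" using P by (rule comm_group_grp)
  show ?thesis unfolding ev_def
  proof (rule finprod_mono_neutral_cong_left)
    show "h p [^]\<^bsub>grp P\<^esub> f p = \<one>\<^bsub>grp P\<^esub>" if "p \<in> A - fsupp f" for p
      using that by (simp add: fsupp_def)
    show "(\<lambda>p. h p [^]\<^bsub>grp P\<^esub> f p) \<in> A \<rightarrow> carrier (grp P)"
      using assms grp_pow_closed[OF P] by (simp add: Pi_iff)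
  qed (use assms in auto)
qed

lemma ev_closed:
  assumes P: "abelian_grp P" and "h \<in> fsupp f \<rightarrow> carr P"
  shows "ev P h f \<in> carr P"
proof -
  interpret comm_group "grp P" using P by (rule comm_group_grp)
  have "ev P h f \<in> carrier (grp P)" unfolding ev_def
    by (rule finprod_closed) (use assms grp_pow_closed[OF P] in \<open>simp add: Pi_iff\<close>)
  then show ?thesis by simp
qed

lemma ev_add:
  assumes P: "abelian_grp P" and fin: "finite (fsupp f)" "finite (fsupp g)"
    and h: "h \<in> fsupp f \<union> fsupp g \<rightarrow> carr P"
  shows "ev P h (\<lambda>q. f q + g q) = addg P (ev P h f) (ev P h g)"
proof -
  interpret comm_group "grp P" using P by (rule comm_group_grp)
  let ?A = "fsupp f \<union> fsupp g"
  have pow: "(\<lambda>p. h p [^]\<^bsub>grp P\<^esub> k p) \<in> ?A \<rightarrow> carrier (grp P)" for k :: "_ \<Rightarrow> int"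
    using h grp_pow_closed[OF P] by (simp add: Pi_iff)
  have *: "fsupp (\<lambda>q. f q + g q) \<subseteq> ?A" by (auto simp: fsupp_def)
  have "ev P h (\<lambda>q. f q + g q) = finprod (grp P) (\<lambda>p. h p [^]\<^bsub>grp P\<^esub> (f p + g p)) ?A"
    by (rule ev_cong_support) (use * fin h P in auto)
  also have "\<dots> = finprod (grp P) (\<lambda>p. h p [^]\<^bsub>grp P\<^esub> f p \<otimes>\<^bsub>grp P\<^esub> h p [^]\<^bsub>grp P\<^esub> g p) ?A"
  proof (rule finprod_cong'[OF refl])
    show "(\<lambda>p. h p [^]\<^bsub>grp P\<^esub> f p \<otimes>\<^bsub>grp P\<^esub> h p [^]\<^bsub>grp P\<^esub> g p) \<in> ?A \<rightarrow> carrier (grp P)"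
      by (intro Pi_I m_closed) (use pow in blast)+
    show "h p [^]\<^bsub>grp P\<^esub> (f p + g p) = h p [^]\<^bsub>grp P\<^esub> f p \<otimes>\<^bsub>grp P\<^esub> h p [^]\<^bsub>grp P\<^esub> g p"
      if "p \<in> ?A" for p
      by (rule int_pow_mult) (use h that in auto)
  qed
  also have "\<dots> = finprod (grp P) (\<lambda>p. h p [^]\<^bsub>grp P\<^esub> f p) ?A \<otimes>\<^bsub>grp P\<^esub> finprod (grp P) (\<lambda>p. h p [^]\<^bsub>grp P\<^esub> g p) ?A"
    by (rule finprod_multf) (rule pow)+
  also have "\<dots> = addg P (ev P h f) (ev P h g)"
    using ev_cong_support[OF P, of ?A f h] ev_cong_support[OF P, of ?A g h] fin h by simp
  finally show ?thesis .
qed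

lemma ev_delta:
  assumes P: "abelian_grp P" and "h p \<in> carr P"
  shows "ev P h (delta p) = h p"
proof -
  interpret comm_group "grp P" using P by (rule comm_group_grp)
  have "fsupp (delta p) = {p}" by (auto simp: fsupp_def delta_def)
  then show ?thesis
    using assms int_pow_1[of "h p"] r_one[of "h p"] by (simp add: ev_def delta_def)
qed

lemma abelian_grpD:
  assumes "abelian_grp G"
  shows "zerog G \<in> carr G"
    and "x \<in> carr G \<Longrightarrow> y \<in> carr G \<Longrightarrow> addg G x y \<in> carr G"
    and "x \<in> carr G \<Longrightarrow> y \<in> carr G \<Longrightarrow> z \<in> carr G \<Longrightarrow> addg G (addg G x y) z = addg G x (addg G y z)"
    and "x \<in> carr G \<Longrightarrow> y \<in> carr G \<Longrightarrow> addg G x y = addg G y x"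
    and "x \<in> carr G \<Longrightarrow> addg G (zerog G) x = x"
    and "x \<in> carr G \<Longrightarrow> addg G x (zerog G) = x"
    and "x \<in> carr G \<Longrightarrow> \<exists>y\<in>carr G. addg G x y = zerog G"
  using assms unfolding abelian_grp_def by metis+

lemma addg_cancel_left:
  assumes "abelian_grp G" "x \<in> carr G" "y \<in> carr G" "z \<in> carr G" "addg G x y = addg G x z"
  shows "y = z"
proof -
  interpret comm_group "grp G" using assms(1) by (rule comm_group_grp)
  show ?thesis using Units_l_cancel[of x y z] assms by (simp add: Units_eq)
qed

lemma addg_cancel_right:
  assumes "abelian_grp G" "x \<in> carr G" "y \<in> carr G" "z \<in> carr G" "addg G y x = addg G z x"
  shows "y = z"
  using addg_cancel_left[of G x y z] abelian_grpD(4) assms by metis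

lemma addg_self_zero:
  assumes "abelian_grp G" "x \<in> carr G" "addg G x x = x"
  shows "x = zerog G"
  using addg_cancel_left[of G x x "zerog G"] abelian_grpD assms by metis

section \<open>Finitely supported integer functions and their push-forward\<close>

definition fsumset :: "'p set \<Rightarrow> ('p \<Rightarrow> int) set" where
  "fsumset C = {f. finite (fsupp f) \<and> fsupp f \<subseteq> C}"

lemma fsumset_zero: "(\<lambda>q. 0) \<in> fsumset C"
  by (simp add: fsumset_def fsupp_def)

lemma fsumset_delta: "p \<in> C \<Longrightarrow> delta p \<in> fsumset C"
  by (auto simp: fsumset_def fsupp_def delta_def)

lemma fsupp_add: "fsupp (\<lambda>q. f q + g q) \<subseteq> fsupp f \<union> fsupp g"
  and fsupp_diff: "fsupp (\<lambda>q. f q - g q) \<subseteq> fsupp f \<union> fsupp g"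
  by (auto simp: fsupp_def)

lemma fsumset_add:
  assumes "f \<in> fsumset C" "g \<in> fsumset C"
  shows "(\<lambda>q. f q + g q) \<in> fsumset C"
  using assms fsupp_add[of f g] finite_subset[OF fsupp_add[of f g]] unfolding fsumset_def by auto

lemma fsumset_diff:
  assumes "f \<in> fsumset C" "g \<in> fsumset C"
  shows "(\<lambda>q. f q - g q) \<in> fsumset C"
  using assms fsupp_diff[of f g] finite_subset[OF fsupp_diff[of f g]] unfolding fsumset_def by auto

text \<open>Moving one nonzero coefficient a unit towards 0 lowers the sum of the absolute values
  and does not enlarge the support, so \<open>0\<close> is reached by adding and removing single
  generators.\<close>

lemma fsumset_induct [consumes 1, case_names zero add diff]:
  assumes "f \<in> fsumset C"
    and zero: "Q (\<lambda>q. 0)"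
    and add: "\<And>f p. f \<in> fsumset C \<Longrightarrow> p \<in> C \<Longrightarrow> Q f \<Longrightarrow> Q (\<lambda>q. f q + delta p q)"
    and diff: "\<And>f p. f \<in> fsumset C \<Longrightarrow> p \<in> C \<Longrightarrow> Q f \<Longrightarrow> Q (\<lambda>q. f q - delta p q)"
  shows "Q f"
  using assms(1)
proof (induction "\<Sum>p\<in>fsupp f. nat \<bar>f p\<bar>" arbitrary: f rule: less_induct)
  case less
  show ?case
  proof (cases "fsupp f = {}")
    case True
    then have "f = (\<lambda>q. 0)" by (auto simp: fsupp_def)
    then show ?thesis using zero by simp
  next
    case False
    then obtain p where p: "p \<in> fsupp f" by blast
    have fin: "finite (fsupp f)" and pC: "p \<in> C" using less.prems p by (auto simp: fsumset_def)
    define g where "g = (\<lambda>q. f q - sgn (f p) * delta p q)"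
    have g_p: "g p = f p - sgn (f p)" and g_q: "q \<noteq> p \<Longrightarrow> g q = f q" for q
      by (auto simp: g_def delta_def)
    have sub: "fsupp g \<subseteq> fsupp f" using p g_q g_p by (fastforce simp: fsupp_def)
    have gC: "g \<in> fsumset C"
      using less.prems sub finite_subset[OF sub fin] by (auto simp: fsumset_def)
    have "(\<Sum>q\<in>fsupp g. nat \<bar>g q\<bar>) = (\<Sum>q\<in>fsupp f. nat \<bar>g q\<bar>)"
      by (rule sum.mono_neutral_left) (use fin sub in \<open>auto simp: fsupp_def\<close>)
    also have "\<dots> < (\<Sum>q\<in>fsupp f. nat \<bar>f q\<bar>)"
    proof (rule sum_strict_mono_ex1[OF fin])
      have "f p \<noteq> 0" using p by (simp add: fsupp_def)
      then have *: "nat \<bar>g p\<bar> < nat \<bar>f p\<bar>" using g_p by (auto simp: sgn_if)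
      then show "\<exists>q\<in>fsupp f. nat \<bar>g q\<bar> < nat \<bar>f q\<bar>" using p by blast
      show "\<forall>q\<in>fsupp f. nat \<bar>g q\<bar> \<le> nat \<bar>f q\<bar>" using * g_q by (metis less_imp_le order_refl)
    qed
    finally have IH: "Q g" using less.hyps gC by blast
    have "f p \<noteq> 0" using p by (simp add: fsupp_def)
    then consider "f p > 0" | "f p < 0" by linarith
    then show ?thesis
    proof cases
      case 1
      then have "f = (\<lambda>q. g q + delta p q)" by (auto simp: g_def)
      then show ?thesis using add[OF gC pC IH] by simp
    next
      case 2
      then have "f = (\<lambda>q. g q - delta p q)" by (auto simp: g_def)
      then show ?thesis using diff[OF gC pC IH] by simp
    qed
  qed
qed

lemma push_superset:
  assumes "finite A" "fsupp f \<subseteq> A"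
  shows "push \<phi> f q = (\<Sum>p\<in>{p \<in> A. \<phi> p = q}. f p)"
  unfolding push_def
  by (rule sum.mono_neutral_left) (use assms in \<open>auto simp: fsupp_def\<close>)

lemma push_add:
  assumes "finite (fsupp f)" "finite (fsupp g)"
  shows "push \<phi> (\<lambda>q. f q + g q) = (\<lambda>q. push \<phi> f q + push \<phi> g q)"
proof
  fix q
  have "finite (fsupp f \<union> fsupp g)" using assms by simp
  from push_superset[OF this, of "\<lambda>q. f q + g q" \<phi> q] push_superset[OF this, of f \<phi> q]
    push_superset[OF this, of g \<phi> q]
  show "push \<phi> (\<lambda>q. f q + g q) q = push \<phi> f q + push \<phi> g q"
    using fsupp_add[of f g] by (simp add: sum.distrib)
qed

lemma push_delta: "push \<phi> (delta p) = delta (\<phi> p)"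
proof
  fix q
  have "push \<phi> (delta p) q = (\<Sum>r\<in>{r \<in> {p}. \<phi> r = q}. delta p r)"
    by (rule push_superset) (auto simp: fsupp_def delta_def)
  also have "{r \<in> {p}. \<phi> r = q} = (if \<phi> p = q then {p} else {})" by auto
  finally show "push \<phi> (delta p) q = delta (\<phi> p) q" by (auto simp: delta_def)
qed

lemma push_fsumset:
  assumes "f \<in> fsumset C" "\<phi> \<in> C \<rightarrow> D"
  shows "push \<phi> f \<in> fsumset D"
proof -
  have "fsupp (push \<phi> f) \<subseteq> \<phi> ` fsupp f"
  proof
    fix q assume "q \<in> fsupp (push \<phi> f)"
    then have "push \<phi> f q \<noteq> 0" by (simp add: fsupp_def)
    then have "{p \<in> fsupp f. \<phi> p = q} \<noteq> {}" unfolding push_def by (metis sum.empty)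
    then show "q \<in> \<phi> ` fsupp f" by auto
  qed
  then show ?thesis using assms unfolding fsumset_def
    by simp (metis (no_types, lifting) Pi_mem finite_imageI finite_subset image_subsetI subset_iff)
qed

definition balanced_map where
  "balanced_map M N P h \<longleftrightarrow>
     (\<forall>x\<in>carr M. \<forall>y\<in>carr N. h x y \<in> carr P) \<and>
     (\<forall>x\<in>carr M. \<forall>x'\<in>carr M. \<forall>y\<in>carr N. h (addg M x x') y = addg P (h x y) (h x' y)) \<and>
     (\<forall>x\<in>carr M. \<forall>y\<in>carr N. \<forall>y'\<in>carr N. h x (addg N y y') = addg P (h x y) (h x y')) \<and>
     (\<forall>x\<in>carr M. \<forall>y\<in>carr N. \<forall>r. h (ract M x r) y = h x (lact N r y))"

section \<open>Universal property and module structure of the tensor product\<close>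

lemma addg_swap:
  assumes G: "abelian_grp G" and "a \<in> carr G" "b \<in> carr G" "c \<in> carr G" "d \<in> carr G"
  shows "addg G (addg G a b) (addg G c d) = addg G (addg G a c) (addg G b d)"
proof -
  interpret comm_group "grp G" using G by (rule comm_group_grp)
  show ?thesis
    using m_ac(1)[of a b "addg G c d"] m_ac(3)[of b c d] m_ac(1)[of a c "addg G b d"] m_closed[of c d] m_closed[of b d] assms
    by simp
qed

lemma right_modD:
  assumes "right_mod M"
  shows "abelian_grp M"
    and "x \<in> carr M \<Longrightarrow> ract M x r \<in> carr M"
    and "x \<in> carr M \<Longrightarrow> y \<in> carr M \<Longrightarrow> ract M (addg M x y) r = addg M (ract M x r) (ract M y r)"
    and "x \<in> carr M \<Longrightarrow> ract M x (r + s) = addg M (ract M x r) (ract M x s)"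
    and "x \<in> carr M \<Longrightarrow> ract M x (r * s) = ract M (ract M x r) s"
    and "x \<in> carr M \<Longrightarrow> ract M x 1 = x"
  using assms by (simp_all add: right_mod_def)

lemma left_modD:
  assumes "left_mod M"
  shows "abelian_grp M"
    and "x \<in> carr M \<Longrightarrow> lact M l x \<in> carr M"
    and "x \<in> carr M \<Longrightarrow> y \<in> carr M \<Longrightarrow> lact M l (addg M x y) = addg M (lact M l x) (lact M l y)"
    and "x \<in> carr M \<Longrightarrow> lact M (l + k) x = addg M (lact M l x) (lact M k x)"
    and "x \<in> carr M \<Longrightarrow> lact M (l * k) x = lact M l (lact M k x)"
    and "x \<in> carr M \<Longrightarrow> lact M 1 x = x"
  using assms by (simp_all add: left_mod_def)

lemma ab_homD:
  assumes "ab_hom M N f"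
  shows "x \<in> carr M \<Longrightarrow> f x \<in> carr N"
    and "x \<in> carr M \<Longrightarrow> y \<in> carr M \<Longrightarrow> f (addg M x y) = addg N (f x) (f y)"
  using assms by (auto simp: ab_hom_def)

lemma right_homD:
  assumes "right_hom M N f"
  shows "ab_hom M N f"
    and "x \<in> carr M \<Longrightarrow> f x \<in> carr N"
    and "x \<in> carr M \<Longrightarrow> y \<in> carr M \<Longrightarrow> f (addg M x y) = addg N (f x) (f y)"
    and "x \<in> carr M \<Longrightarrow> f (ract M x r) = ract N (f x) r"
  using assms by (auto simp: right_hom_def ab_hom_def)

lemma left_homD:
  assumes "left_hom M N f"
  shows "ab_hom M N f"
    and "x \<in> carr M \<Longrightarrow> f x \<in> carr N"
    and "x \<in> carr M \<Longrightarrow> y \<in> carr M \<Longrightarrow> f (addg M x y) = addg N (f x) (f y)"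
    and "x \<in> carr M \<Longrightarrow> f (lact M l x) = lact N l (f x)"
  using assms by (auto simp: left_hom_def ab_hom_def)

lemma balanced_mapD:
  assumes "balanced_map M N P h"
  shows "x \<in> carr M \<Longrightarrow> y \<in> carr N \<Longrightarrow> h x y \<in> carr P"
    and "x \<in> carr M \<Longrightarrow> x' \<in> carr M \<Longrightarrow> y \<in> carr N \<Longrightarrow> h (addg M x x') y = addg P (h x y) (h x' y)"
    and "x \<in> carr M \<Longrightarrow> y \<in> carr N \<Longrightarrow> y' \<in> carr N \<Longrightarrow> h x (addg N y y') = addg P (h x y) (h x y')"
    and "x \<in> carr M \<Longrightarrow> y \<in> carr N \<Longrightarrow> h (ract M x r) y = h x (lact N r y)"
  using assms unfolding balanced_map_def by blast+

text \<open>The two actions on \<open>N\<close> must commute for the right action to descend to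
  \<open>tensor M N\<close>. A left action on \<open>M\<close> is added only in
  \<open>left_tens_pair\<close>, since for objects of \<open>Mod_B\<close> the field
  \<open>lact\<close> carries no meaning.\<close>

locale tens_pair =
  fixes M :: "('m,'l,'r::ring_1,'x) bimod_scheme" and N :: "('n,'r,'t::ring_1,'y) bimod_scheme"
  assumes right_M: "right_mod M" and left_N: "left_mod N" and right_N: "right_mod N"
    and comm_N: "y \<in> carr N \<Longrightarrow> lact N r (ract N y t) = ract N (lact N r y) t"
begin

abbreviation C where "C \<equiv> carr M \<times> carr N"

lemma fsums_eq: "fsums M N = fsumset C"
  by (simp add: fsums_def fsumset_def)

lemma trel_fsumset: "f \<in> trel M N \<Longrightarrow> f \<in> fsumset C"
proof (induction rule: trel.induct)
  case (add_left x x' y)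
  then have "addg M x x' \<in> carr M" by (intro abelian_grpD(2)[OF right_modD(1)[OF right_M]])
  then show ?case using add_left by (intro fsumset_diff fsumset_delta) auto
next
  case (add_right x y y')
  then have "addg N y y' \<in> carr N" by (intro abelian_grpD(2)[OF left_modD(1)[OF left_N]])
  then show ?case using add_right by (intro fsumset_diff fsumset_delta) auto
next
  case (balanced x y r)
  then show ?case using right_modD(2)[OF right_M, of x r] left_modD(2)[OF left_N, of y r]
    by (intro fsumset_diff fsumset_delta) auto
qed (simp_all add: fsumset_diff fsumset_zero)

lemma trel_neg:
  assumes "f \<in> trel M N"
  shows "(\<lambda>q. - f q) \<in> trel M N"
  using trel.diff[OF trel.zero assms] by simp

lemma trel_add:
  assumes "f \<in> trel M N" "g \<in> trel M N"
  shows "(\<lambda>q. f q + g q) \<in> trel M N"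
  using trel.diff[OF assms(1) trel_neg[OF assms(2)]] by simp

text \<open>\<open>trel\<close> contains zero and is closed under differences, hence is a subgroup;
  classes are its cosets.\<close>

lemma tclass_eq_iff:
  assumes "f \<in> fsumset C" "g \<in> fsumset C"
  shows "tclass M N f = tclass M N g \<longleftrightarrow> (\<lambda>q. f q - g q) \<in> trel M N"
proof
  assume "tclass M N f = tclass M N g"
  moreover have "g \<in> tclass M N g" using assms trel.zero[of M N] by (simp add: tclass_def fsums_eq)
  ultimately have "g \<in> tclass M N f" by metis
  then show "(\<lambda>q. f q - g q) \<in> trel M N" unfolding tclass_def by blast
next
  assume *: "(\<lambda>q. f q - g q) \<in> trel M N"
  have "(\<lambda>q. f q - k q) \<in> trel M N \<longleftrightarrow> (\<lambda>q. g q - k q) \<in> trel M N" for k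
  proof
    assume "(\<lambda>q. f q - k q) \<in> trel M N"
    from trel.diff[OF this *] show "(\<lambda>q. g q - k q) \<in> trel M N" by simp
  next
    assume "(\<lambda>q. g q - k q) \<in> trel M N"
    from trel_add[OF * this] show "(\<lambda>q. f q - k q) \<in> trel M N" by simp
  qed
  then show "tclass M N f = tclass M N g" unfolding tclass_def by blast
qed

lemma trep_tclass:
  assumes "f \<in> fsumset C"
  shows "trep (tclass M N f) \<in> fsumset C" "(\<lambda>q. f q - trep (tclass M N f) q) \<in> trel M N"
    "tclass M N (trep (tclass M N f)) = tclass M N f"
proof -
  have "f \<in> tclass M N f" using assms trel.zero[of M N] by (simp add: tclass_def fsums_eq)
  then have "trep (tclass M N f) \<in> tclass M N f" unfolding trep_def by (rule someI[of "\<lambda>g. g \<in> tclass M N f"])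
  then show 1: "trep (tclass M N f) \<in> fsumset C" and "(\<lambda>q. f q - trep (tclass M N f) q) \<in> trel M N"
    by (auto simp: tclass_def fsums_eq)
  then show "tclass M N (trep (tclass M N f)) = tclass M N f"
    using tclass_eq_iff[OF assms 1] by simp
qed

lemma carr_tensor: "carr (tensor M N) = tclass M N ` fsumset C"
  by (simp add: tensor_def fsums_eq)

lemma tclass_carr: "f \<in> fsumset C \<Longrightarrow> tclass M N f \<in> carr (tensor M N)"
  by (simp add: carr_tensor)

lemma tclass_add:
  assumes f: "f \<in> fsumset C" and g: "g \<in> fsumset C"
  shows "addg (tensor M N) (tclass M N f) (tclass M N g) = tclass M N (\<lambda>q. f q + g q)"
proof -
  let ?f = "trep (tclass M N f)" and ?g = "trep (tclass M N g)"
  have "tclass M N (\<lambda>q. f q + g q) = tclass M N (\<lambda>q. ?f q + ?g q)"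
    using trel_add[OF trep_tclass(2)[OF f] trep_tclass(2)[OF g]]
    by (subst tclass_eq_iff) (auto intro!: fsumset_add f g trep_tclass simp: algebra_simps)
  then show ?thesis by (simp add: tensor_def)
qed

lemma zerog_tensor: "zerog (tensor M N) = tclass M N (\<lambda>q. 0)"
  by (simp add: tensor_def)

lemma abelian_tensor: "abelian_grp (tensor M N)"
  unfolding abelian_grp_def
proof (intro conjI ballI)
  show "zerog (tensor M N) \<in> carr (tensor M N)"
    by (simp add: zerog_tensor tclass_carr fsumset_zero)
  fix A assume "A \<in> carr (tensor M N)"
  then obtain f where f: "f \<in> fsumset C" "A = tclass M N f" by (auto simp: carr_tensor)
  show "addg (tensor M N) (zerog (tensor M N)) A = A"
    using f by (simp add: zerog_tensor tclass_add fsumset_zero)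
  have neg: "(\<lambda>q. - f q) \<in> fsumset C" using fsumset_diff[OF fsumset_zero f(1)] by simp
  then show "\<exists>B\<in>carr (tensor M N). addg (tensor M N) A B = zerog (tensor M N)"
    using f by (intro bexI[of _ "tclass M N (\<lambda>q. - f q)"]) (simp_all add: zerog_tensor tclass_add tclass_carr)
  fix B assume "B \<in> carr (tensor M N)"
  then obtain g where g: "g \<in> fsumset C" "B = tclass M N g" by (auto simp: carr_tensor)
  show "addg (tensor M N) A B \<in> carr (tensor M N)"
    using f g by (simp add: tclass_add tclass_carr fsumset_add)
  show "addg (tensor M N) A B = addg (tensor M N) B A"
    using f g by (simp add: tclass_add add.commute)
  fix D assume "D \<in> carr (tensor M N)"
  then obtain h where h: "h \<in> fsumset C" "D = tclass M N h" by (auto simp: carr_tensor)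
  show "addg (tensor M N) (addg (tensor M N) A B) D = addg (tensor M N) A (addg (tensor M N) B D)"
    using f g h by (simp add: tclass_add fsumset_add add.assoc)
qed

lemma tens_closed: "x \<in> carr M \<Longrightarrow> y \<in> carr N \<Longrightarrow> tens M N x y \<in> carr (tensor M N)"
  by (simp add: tens_def tclass_carr fsumset_delta)

lemma abM: "abelian_grp M" and abN: "abelian_grp N"
  using right_M left_N by (simp_all add: right_mod_def left_mod_def)

lemma balanced_tens: "balanced_map M N (tensor M N) (tens M N)"
  unfolding balanced_map_def
proof (intro conjI ballI allI)
  fix x y assume x: "x \<in> carr M" and y: "y \<in> carr N"
  show "tens M N x y \<in> carr (tensor M N)" by (rule tens_closed[OF x y])
  show "tens M N (ract M x r) y = tens M N x (lact N r y)" for r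
    unfolding tens_def using x y trel.balanced[OF x y, of r] right_modD(2)[OF right_M x, of r]
      left_modD(2)[OF left_N y, of r]
    by (subst tclass_eq_iff) (auto intro!: fsumset_delta)
  show "tens M N x (addg N y y') = addg (tensor M N) (tens M N x y) (tens M N x y')"
    if y': "y' \<in> carr N" for y'
    unfolding tens_def using x y y' trel.add_right[OF x y y'] abelian_grpD(2)[OF abN y y']
    by (simp add: tclass_add tclass_eq_iff fsumset_delta fsumset_add algebra_simps)
next
  fix x x' y assume x: "x \<in> carr M" and x': "x' \<in> carr M" and y: "y \<in> carr N"
  show "tens M N (addg M x x') y = addg (tensor M N) (tens M N x y) (tens M N x' y)"
    unfolding tens_def using x y x' trel.add_left[OF x x' y] abelian_grpD(2)[OF abM x x']
    by (simp add: tclass_add tclass_eq_iff fsumset_delta fsumset_add algebra_simps)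
qed

lemmas tens_add_left = balanced_mapD(2)[OF balanced_tens]
  and tens_add_right = balanced_mapD(3)[OF balanced_tens]
  and tens_balanced = balanced_mapD(4)[OF balanced_tens]

lemma tens_zero_left:
  assumes "y \<in> carr N" shows "tens M N (zerog M) y = zerog (tensor M N)"
proof -
  have z: "zerog M \<in> carr M" "addg M (zerog M) (zerog M) = zerog M" using abelian_grpD[OF abM] by auto
  show ?thesis
    by (rule addg_self_zero[OF abelian_tensor tens_closed[OF z(1) assms]])
      (use tens_add_left[OF z(1) z(1) assms] z in simp)
qed

text \<open>The negative of \<open>x \<otimes> y\<close> is \<open>(-x) \<otimes> y\<close>, and
  \<open>0\<close> is itself a pure tensor, so sums of pure tensors exhaust the tensor product and
  neither zero nor differences need a case.\<close>

lemma tensor_induct [consumes 1, case_names tens add]: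
  assumes "A \<in> carr (tensor M N)"
    and tens: "\<And>x y. x \<in> carr M \<Longrightarrow> y \<in> carr N \<Longrightarrow> Q (tens M N x y)"
    and add: "\<And>A B. A \<in> carr (tensor M N) \<Longrightarrow> B \<in> carr (tensor M N) \<Longrightarrow> Q A \<Longrightarrow> Q B \<Longrightarrow>
      Q (addg (tensor M N) A B)"
  shows "Q A"
proof -
  obtain f where f: "f \<in> fsumset C" "A = tclass M N f" using assms(1) by (auto simp: carr_tensor)
  have "Q (tclass M N f)" using f(1)
  proof (induction rule: fsumset_induct)
    case zero
    show ?case using tens[of "zerog M" "zerog N"] tens_zero_left abelian_grpD(1)[OF abM] abelian_grpD(1)[OF abN]
      by (simp add: zerog_tensor)
  next
    case (add f p)
    then show ?case using assms(3)[of "tclass M N f" "tens M N (fst p) (snd p)"] tens[of "fst p" "snd p"]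
      by (auto simp: tens_def tclass_add tclass_carr fsumset_delta)
  next
    case (diff f p)
    obtain x y where p: "p = (x, y)" "x \<in> carr M" "y \<in> carr N" using diff by auto
    \<comment> \<open>\<open>x'\<close> is the negative of \<open>x\<close>: subtracting the
      generator \<open>(x, y)\<close> is the same, modulo \<open>trel\<close>, as adding
      \<open>(x', y)\<close>.\<close>
    obtain x' where x': "x' \<in> carr M" "addg M x x' = zerog M" using abelian_grpD(7)[OF abM p(2)] by auto
    have "addg (tensor M N) (tens M N x y) (tens M N x' y) = zerog (tensor M N)"
      using tens_add_left[OF p(2) x'(1) p(3)] x' tens_zero_left p by simp
    then have z: "tclass M N (\<lambda>q. delta p q + delta (x', y) q) = tclass M N (\<lambda>q. 0)"
      using p x' by (simp add: tens_def tclass_add fsumset_delta zerog_tensor)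
    have "(\<lambda>q. delta p q + delta (x', y) q) \<in> trel M N"
      using z tclass_eq_iff[of "\<lambda>q. delta p q + delta (x', y) q" "\<lambda>q. 0"] p x'
      by (simp add: fsumset_add fsumset_delta fsumset_zero)
    then have "tclass M N (\<lambda>q. f q + delta (x', y) q) = tclass M N (\<lambda>q. f q - delta p q)"
      using diff p x' by (subst tclass_eq_iff) (auto intro!: fsumset_add fsumset_diff fsumset_delta simp: algebra_simps)
    moreover have "Q (tclass M N (\<lambda>q. f q + delta (x', y) q))"
      using assms(3)[of "tclass M N f" "tens M N x' y"] tens[of x' y] p x' diff
      by (auto simp: tens_def tclass_add tclass_carr fsumset_delta)
    ultimately show ?case by simp
  qed
  then show ?thesis using f by simp
qed

lemma tensor_hom_eqI:
  assumes "A \<in> carr (tensor M N)" "ab_hom (tensor M N) P F" "ab_hom (tensor M N) P G"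
    and "\<And>x y. x \<in> carr M \<Longrightarrow> y \<in> carr N \<Longrightarrow> F (tens M N x y) = G (tens M N x y)"
  shows "F A = G A"
  using assms(1) by (induction rule: tensor_induct) (use assms in \<open>auto simp: ab_homD\<close>)

text \<open>An additive \<open>\<psi>\<close> that is balanced on generators vanishes on each
  generating relation, hence on \<open>trel\<close>, so its value does not depend on the
  representative picked by \<open>trep\<close>. It is stated for an abstract \<open>\<psi>\<close>
  because it serves twice: with \<open>ev\<close> for \<open>tlift\<close>, and with
  \<open>push\<close> for all maps given by generators.\<close>

lemma induced_hom:
  assumes P: "abelian_grp P"
    and cl: "\<And>f. f \<in> fsumset C \<Longrightarrow> \<psi> f \<in> carr P"
    and add: "\<And>f g. f \<in> fsumset C \<Longrightarrow> g \<in> fsumset C \<Longrightarrow> \<psi> (\<lambda>q. f q + g q) = addg P (\<psi> f) (\<psi> g)"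
    and h: "balanced_map M N P (\<lambda>x y. \<psi> (delta (x, y)))"
  shows "ab_hom (tensor M N) P (\<lambda>A. \<psi> (trep A))"
    and "x \<in> carr M \<Longrightarrow> y \<in> carr N \<Longrightarrow> \<psi> (trep (tens M N x y)) = \<psi> (delta (x, y))"
proof -
  \<comment> \<open>Only additivity of \<open>\<psi>\<close> is given; its vanishing on a difference
    is obtained by cancelling \<open>\<psi> g\<close> in \<open>P\<close>.\<close>
  have diff0: "\<psi> (\<lambda>q. f q - g q) = zerog P"
    if fg: "f \<in> fsumset C" "g \<in> fsumset C" and eq: "\<psi> f = \<psi> g" for f g
  proof (rule addg_cancel_right[OF P cl[OF fg(2)]])
    show "addg P (\<psi> (\<lambda>q. f q - g q)) (\<psi> g) = addg P (zerog P) (\<psi> g)"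
      using add[OF fsumset_diff[OF fg] fg(2)] eq abelian_grpD(5)[OF P cl[OF fg(2)]] by simp
  qed (use cl fsumset_diff fg abelian_grpD(1)[OF P] in auto)
  have 0: "\<psi> (\<lambda>q. 0) = zerog P"
    using diff0[OF fsumset_zero fsumset_zero] by simp
  have trel0: "\<psi> f = zerog P" if "f \<in> trel M N" for f
    using that
  proof (induction rule: trel.induct)
    case (add_left x x' y)
    then have d: "delta (x, y) \<in> fsumset C" "delta (x', y) \<in> fsumset C" "delta (addg M x x', y) \<in> fsumset C"
      using abelian_grpD(2)[OF abM] by (auto intro!: fsumset_delta)
    show ?case
      using diff0[OF d(3) fsumset_add[OF d(1,2)]] add[OF d(1,2)] balanced_mapD(2)[OF h add_left]
      by (simp add: algebra_simps)
  next
    case (add_right x y y')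
    then have d: "delta (x, y) \<in> fsumset C" "delta (x, y') \<in> fsumset C" "delta (x, addg N y y') \<in> fsumset C"
      using abelian_grpD(2)[OF abN] by (auto intro!: fsumset_delta)
    show ?case
      using diff0[OF d(3) fsumset_add[OF d(1,2)]] add[OF d(1,2)] balanced_mapD(3)[OF h add_right]
      by (simp add: algebra_simps)
  next
    case (balanced x y r)
    then show ?case
      using balanced_mapD(4)[OF h balanced, of r] right_modD(2)[OF right_M] left_modD(2)[OF left_N]
      by (intro diff0) (auto intro!: fsumset_delta)
  next
    case (diff f g)
    then show ?case by (intro diff0) (auto simp: trel_fsumset)
  qed (rule 0)
  have \<psi>_cong: "\<psi> f = \<psi> g" if "f \<in> fsumset C" "g \<in> fsumset C" "(\<lambda>q. f q - g q) \<in> trel M N" for f g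
    using add[OF fsumset_diff[OF that(1,2)] that(2)] trel0[OF that(3)] abelian_grpD(5)[OF P cl[OF that(2)]]
    by simp
  have rep: "\<psi> (trep (tclass M N f)) = \<psi> f" if "f \<in> fsumset C" for f
    by (rule \<psi>_cong[OF that trep_tclass(1,2)[OF that], symmetric])
  show "x \<in> carr M \<Longrightarrow> y \<in> carr N \<Longrightarrow> \<psi> (trep (tens M N x y)) = \<psi> (delta (x, y))"
    unfolding tens_def by (rule rep) (auto intro!: fsumset_delta)
  show "ab_hom (tensor M N) P (\<lambda>A. \<psi> (trep A))"
    unfolding ab_hom_def
    using rep cl add by (auto simp: carr_tensor tclass_add fsumset_add)
qed

text \<open>\<open>tlift\<close> is a definite description, so existence and uniqueness are both
  due. The restriction of \<open>ev\<close> to the carrier exists; agreement on pure tensors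
  together with extensionality makes it unique.\<close>

lemma tlift:
  assumes P: "abelian_grp P" and h: "balanced_map M N P h"
  shows tlift_extensional: "tlift M N P h \<in> extensional (carr (tensor M N))"
    and tlift_hom: "ab_hom (tensor M N) P (tlift M N P h)"
    and tlift_tens: "x \<in> carr M \<Longrightarrow> y \<in> carr N \<Longrightarrow> tlift M N P h (tens M N x y) = h x y"
proof -
  let ?h = "\<lambda>p. h (fst p) (snd p)"
  let ?Q = "\<lambda>F. F \<in> extensional (carr (tensor M N)) \<and> ab_hom (tensor M N) P F \<and>
       (\<forall>x\<in>carr M. \<forall>y\<in>carr N. F (tens M N x y) = h x y)"
  have hC: "?h \<in> C \<rightarrow> carr P" using balanced_mapD(1)[OF h] by auto
  have d: "ev P ?h (delta (x, y)) = h x y" if "x \<in> carr M" "y \<in> carr N" for x y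
    using ev_delta[OF P, of ?h "(x, y)"] balanced_mapD(1)[OF h that] by simp
  have ind: "ab_hom (tensor M N) P (\<lambda>A. ev P ?h (trep A))"
    "\<And>x y. x \<in> carr M \<Longrightarrow> y \<in> carr N \<Longrightarrow> ev P ?h (trep (tens M N x y)) = ev P ?h (delta (x, y))"
  proof -
    have 1: "ev P ?h f \<in> carr P" if "f \<in> fsumset C" for f
      using that hC by (intro ev_closed[OF P]) (auto simp: fsumset_def)
    have 2: "ev P ?h (\<lambda>q. f q + g q) = addg P (ev P ?h f) (ev P ?h g)"
      if "f \<in> fsumset C" "g \<in> fsumset C" for f g
      using that hC by (intro ev_add[OF P]) (auto simp: fsumset_def)
    have 3: "balanced_map M N P (\<lambda>x y. ev P ?h (delta (x, y)))"
      using h d abelian_grpD(2)[OF abM] abelian_grpD(2)[OF abN] right_modD(2)[OF right_M] left_modD(2)[OF left_N]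
      unfolding balanced_map_def by simp
    show "ab_hom (tensor M N) P (\<lambda>A. ev P ?h (trep A))" by (rule induced_hom(1)[OF P 1 2 3])
    show "ev P ?h (trep (tens M N x y)) = ev P ?h (delta (x, y))"
      if "x \<in> carr M" "y \<in> carr N" for x y by (rule induced_hom(2)[OF P 1 2 3 that])
  qed
  define F where "F = restrict (\<lambda>A. ev P ?h (trep A)) (carr (tensor M N))"
  have F: "?Q F"
    using ind d tens_closed abelian_grpD(2)[OF abelian_tensor] by (auto simp: F_def ab_hom_def)
  have "?Q (tlift M N P h)"
    unfolding tlift_def
  proof (rule theI[of ?Q, OF F])
    fix G assume G: "?Q G"
    show "G = F"
    proof (rule extensionalityI[of _ "carr (tensor M N)"])
      fix A assume "A \<in> carr (tensor M N)"
      then show "G A = F A" by (rule tensor_hom_eqI[of _ P]) (use F G in auto)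
    qed (use F G in auto)
  qed
  then show "tlift M N P h \<in> extensional (carr (tensor M N))" "ab_hom (tensor M N) P (tlift M N P h)"
    "x \<in> carr M \<Longrightarrow> y \<in> carr N \<Longrightarrow> tlift M N P h (tens M N x y) = h x y"
    by auto
qed

text \<open>\<open>tinduce\<close>, \<open>tmap\<close> and both actions on a tensor product all
  push generators forward and then take the class, so their well-definedness is settled here
  once.\<close>

lemma push_hom:
  assumes "tens_pair M' N'" and \<phi>: "\<phi> \<in> C \<rightarrow> carr M' \<times> carr N'"
    and h: "balanced_map M N (tensor M' N') (\<lambda>x y. tens M' N' (fst (\<phi> (x, y))) (snd (\<phi> (x, y))))"
  shows "ab_hom (tensor M N) (tensor M' N') (\<lambda>A. tclass M' N' (push \<phi> (trep A)))"
    and "x \<in> carr M \<Longrightarrow> y \<in> carr N \<Longrightarrow> tclass M' N' (push \<phi> (trep (tens M N x y))) =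
       tens M' N' (fst (\<phi> (x, y))) (snd (\<phi> (x, y)))"
proof -
  interpret T': tens_pair M' N' by fact
  have 1: "tclass M' N' (push \<phi> f) \<in> carr (tensor M' N')" if "f \<in> fsumset C" for f
    by (rule T'.tclass_carr[OF push_fsumset[OF that \<phi>]])
  have 2: "tclass M' N' (push \<phi> (\<lambda>q. f q + g q)) =
      addg (tensor M' N') (tclass M' N' (push \<phi> f)) (tclass M' N' (push \<phi> g))"
    if "f \<in> fsumset C" "g \<in> fsumset C" for f g
    using T'.tclass_add[OF push_fsumset[OF that(1) \<phi>] push_fsumset[OF that(2) \<phi>]] that
    by (simp add: push_add fsumset_def)
  have 3: "balanced_map M N (tensor M' N') (\<lambda>x y. tclass M' N' (push \<phi> (delta (x, y))))"
    using h by (simp add: push_delta tens_def)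
  show "ab_hom (tensor M N) (tensor M' N') (\<lambda>A. tclass M' N' (push \<phi> (trep A)))"
    by (rule induced_hom(1)[OF T'.abelian_tensor 1 2 3])
  show "tclass M' N' (push \<phi> (trep (tens M N x y))) = tens M' N' (fst (\<phi> (x, y))) (snd (\<phi> (x, y)))"
    if "x \<in> carr M" "y \<in> carr N"
    using induced_hom(2)[OF T'.abelian_tensor 1 2 3 that]
    unfolding tens_def[of M' N'] push_delta prod.collapse .
qed

lemma tinduce:
  assumes "tens_pair M' N'" and \<phi>: "\<phi> \<in> C \<rightarrow> carr M' \<times> carr N'"
    and h: "balanced_map M N (tensor M' N') (\<lambda>x y. tens M' N' (fst (\<phi> (x, y))) (snd (\<phi> (x, y))))"
  shows tinduce_hom: "ab_hom (tensor M N) (tensor M' N') (tinduce M N M' N' \<phi>)"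
    and tinduce_tens: "x \<in> carr M \<Longrightarrow> y \<in> carr N \<Longrightarrow>
      tinduce M N M' N' \<phi> (tens M N x y) = tens M' N' (fst (\<phi> (x, y))) (snd (\<phi> (x, y)))"
  using push_hom[OF assms] tens_closed abelian_grpD(2)[OF abelian_tensor]
  by (auto simp: tinduce_def ab_hom_def)

lemma tmap:
  assumes "tens_pair M' N'" and f: "right_hom M M' f" and g: "left_hom N N' g"
  shows tmap_hom: "ab_hom (tensor M N) (tensor M' N') (tmap M N M' N' f g)"
    and tmap_tens: "x \<in> carr M \<Longrightarrow> y \<in> carr N \<Longrightarrow>
      tmap M N M' N' f g (tens M N x y) = tens M' N' (f x) (g y)"
proof -
  interpret T': tens_pair M' N' by fact
  let ?\<phi> = "\<lambda>(x, y). (f x, g y)"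
  have \<phi>: "?\<phi> \<in> C \<rightarrow> carr M' \<times> carr N'" using right_homD(2)[OF f] left_homD(2)[OF g] by auto
  have h: "balanced_map M N (tensor M' N') (\<lambda>x y. tens M' N' (fst (?\<phi> (x, y))) (snd (?\<phi> (x, y))))"
    unfolding balanced_map_def
    by (simp add: right_homD[OF f] left_homD[OF g] T'.tens_closed T'.tens_add_left T'.tens_add_right T'.tens_balanced)
  show "ab_hom (tensor M N) (tensor M' N') (tmap M N M' N' f g)"
    unfolding tmap_def by (rule tinduce_hom[OF assms(1) \<phi> h])
  show "tmap M N M' N' f g (tens M N x y) = tens M' N' (f x) (g y)" if "x \<in> carr M" "y \<in> carr N"
    unfolding tmap_def using tinduce_tens[OF assms(1) \<phi> h that] by simp
qed

lemma ract_tensor: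
  shows ract_tensor_hom: "ab_hom (tensor M N) (tensor M N) (\<lambda>A. ract (tensor M N) A t)"
    and ract_tens: "x \<in> carr M \<Longrightarrow> y \<in> carr N \<Longrightarrow> ract (tensor M N) (tens M N x y) t = tens M N x (ract N y t)"
proof -
  let ?\<phi> = "\<lambda>(x, y). (x, ract N y t)"
  have \<phi>: "?\<phi> \<in> C \<rightarrow> C" using right_modD(2)[OF right_N] by auto
  have h: "balanced_map M N (tensor M N) (\<lambda>x y. tens M N (fst (?\<phi> (x, y))) (snd (?\<phi> (x, y))))"
    unfolding balanced_map_def
    by (simp add: right_modD[OF right_N] comm_N[symmetric] tens_closed tens_add_left tens_add_right tens_balanced)
  have eq: "(\<lambda>A. ract (tensor M N) A t) = (\<lambda>A. tclass M N (push ?\<phi> (trep A)))" by (simp add: tensor_def)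
  show "ab_hom (tensor M N) (tensor M N) (\<lambda>A. ract (tensor M N) A t)"
    unfolding eq by (rule push_hom(1)[OF tens_pair_axioms \<phi> h])
  show "ract (tensor M N) (tens M N x y) t = tens M N x (ract N y t)" if "x \<in> carr M" "y \<in> carr N"
    using push_hom(2)[OF tens_pair_axioms \<phi> h that] by (simp add: tensor_def)
qed

lemmas ract_tensor_closed = ab_homD(1)[OF ract_tensor_hom]
  and ract_tensor_add = ab_homD(2)[OF ract_tensor_hom]

lemma right_mod_tensor: "right_mod (tensor M N)"
proof -
  note ab = abelian_grpD(2)[OF abelian_tensor]
  have "ract (tensor M N) A (l + k) = addg (tensor M N) (ract (tensor M N) A l) (ract (tensor M N) A k)"
    if "A \<in> carr (tensor M N)" for A l k
    using that
  proof (induction rule: tensor_induct)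
    case (tens x y)
    then show ?case by (simp add: ract_tens right_modD[OF right_N] tens_add_right)
  next
    case (add A B)
    have cl: "ract (tensor M N) A s \<in> carr (tensor M N)" "ract (tensor M N) B s \<in> carr (tensor M N)" for s
      using add ract_tensor_closed by auto
    show ?case
      using add by (simp add: ract_tensor_add ab addg_swap[OF abelian_tensor] cl)
  qed
  moreover have "ract (tensor M N) A (l * k) = ract (tensor M N) (ract (tensor M N) A l) k"
    if "A \<in> carr (tensor M N)" for A l k
    using that by (induction rule: tensor_induct)
      (simp_all add: ract_tensor_add ract_tensor_closed ract_tens right_modD[OF right_N])
  moreover have "ract (tensor M N) A 1 = A" if "A \<in> carr (tensor M N)" for A
    using that by (induction rule: tensor_induct)
      (simp_all add: ract_tensor_add ract_tensor_closed ract_tens right_modD[OF right_N])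
  ultimately show ?thesis
    unfolding right_mod_def using abelian_tensor ract_tensor_add ract_tensor_closed by simp
qed

lemma right_hom_tensorI:
  assumes F: "ab_hom (tensor M N) P F" and P: "right_mod P"
    and "\<And>x y t. x \<in> carr M \<Longrightarrow> y \<in> carr N \<Longrightarrow> F (tens M N x (ract N y t)) = ract P (F (tens M N x y)) t"
  shows "right_hom (tensor M N) P F"
proof -
  have "F (ract (tensor M N) A t) = ract P (F A) t" if "A \<in> carr (tensor M N)" for A t
    using that by (induction rule: tensor_induct)
      (simp_all add: ract_tens ract_tensor_add ract_tensor_closed ab_homD[OF F] assms(3) right_modD[OF P])
  then show ?thesis using F by (simp add: right_hom_def)
qed

lemma tmap_right_hom:
  assumes T': "tens_pair M' N'" and f: "right_hom M M' f" and g: "left_hom N N' g" and gr: "right_hom N N' g"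
  shows "right_hom (tensor M N) (tensor M' N') (tmap M N M' N' f g)"
proof -
  interpret T': tens_pair M' N' by fact
  show ?thesis
    by (rule right_hom_tensorI[OF tmap_hom[OF T' f g] T'.right_mod_tensor])
      (simp add: tmap_tens[OF T' f g] right_homD[OF f] right_homD[OF gr] T'.ract_tens right_modD[OF right_N])
qed

end

locale left_tens_pair = tens_pair M N
  for M :: "('m,'l::ring_1,'r::ring_1,'x) bimod_scheme" and N :: "('n,'r,'t::ring_1,'y) bimod_scheme" +
  assumes left_M: "left_mod M"
    and comm_M: "x \<in> carr M \<Longrightarrow> lact M l (ract M x r) = ract M (lact M l x) r"
begin

lemma lact_tensor:
  shows lact_tensor_hom: "ab_hom (tensor M N) (tensor M N) (lact (tensor M N) l)"
    and lact_tens: "x \<in> carr M \<Longrightarrow> y \<in> carr N \<Longrightarrow> lact (tensor M N) l (tens M N x y) = tens M N (lact M l x) y"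
proof -
  let ?\<phi> = "\<lambda>(x, y). (lact M l x, y)"
  have \<phi>: "?\<phi> \<in> C \<rightarrow> C" using left_modD(2)[OF left_M] by auto
  have h: "balanced_map M N (tensor M N) (\<lambda>x y. tens M N (fst (?\<phi> (x, y))) (snd (?\<phi> (x, y))))"
    unfolding balanced_map_def
    by (simp add: left_modD[OF left_M] comm_M tens_closed tens_add_left tens_add_right tens_balanced)
  have eq: "lact (tensor M N) l = (\<lambda>A. tclass M N (push ?\<phi> (trep A)))" by (simp add: tensor_def)
  show "ab_hom (tensor M N) (tensor M N) (lact (tensor M N) l)"
    unfolding eq by (rule push_hom(1)[OF tens_pair_axioms \<phi> h])
  show "lact (tensor M N) l (tens M N x y) = tens M N (lact M l x) y" if "x \<in> carr M" "y \<in> carr N"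
    unfolding eq using push_hom(2)[OF tens_pair_axioms \<phi> h that] by simp
qed

lemmas lact_tensor_closed = ab_homD(1)[OF lact_tensor_hom]
  and lact_tensor_add = ab_homD(2)[OF lact_tensor_hom]

lemma left_mod_tensor: "left_mod (tensor M N)"
proof -
  note ab = abelian_grpD(2)[OF abelian_tensor]
  have "lact (tensor M N) (l + k) A = addg (tensor M N) (lact (tensor M N) l A) (lact (tensor M N) k A)"
    if "A \<in> carr (tensor M N)" for A l k
    using that
  proof (induction rule: tensor_induct)
    case (tens x y)
    then show ?case by (simp add: lact_tens left_modD[OF left_M] tens_add_left)
  next
    case (add A B)
    have cl: "lact (tensor M N) s A \<in> carr (tensor M N)" "lact (tensor M N) s B \<in> carr (tensor M N)" for s
      using add lact_tensor_closed by auto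
    show ?case
      using add by (simp add: lact_tensor_add ab addg_swap[OF abelian_tensor] cl)
  qed
  moreover have "lact (tensor M N) (l * k) A = lact (tensor M N) l (lact (tensor M N) k A)"
    if "A \<in> carr (tensor M N)" for A l k
    using that by (induction rule: tensor_induct)
      (simp_all add: lact_tensor_add lact_tensor_closed lact_tens left_modD[OF left_M])
  moreover have "lact (tensor M N) 1 A = A" if "A \<in> carr (tensor M N)" for A
    using that by (induction rule: tensor_induct)
      (simp_all add: lact_tensor_add lact_tensor_closed lact_tens left_modD[OF left_M])
  ultimately show ?thesis
    unfolding left_mod_def using abelian_tensor lact_tensor_add lact_tensor_closed by simp
qed

lemma lact_ract_tensor:
  assumes "A \<in> carr (tensor M N)"
  shows "lact (tensor M N) l (ract (tensor M N) A t) = ract (tensor M N) (lact (tensor M N) l A) t"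
  using assms by (induction rule: tensor_induct)
    (simp_all add: lact_tensor_add lact_tensor_closed lact_tens ract_tens ract_tensor_add ract_tensor_closed
       left_modD[OF left_M] right_modD[OF right_N])

lemma left_hom_tensorI:
  assumes F: "ab_hom (tensor M N) P F" and P: "left_mod P"
    and "\<And>x y l. x \<in> carr M \<Longrightarrow> y \<in> carr N \<Longrightarrow> F (tens M N (lact M l x) y) = lact P l (F (tens M N x y))"
  shows "left_hom (tensor M N) P F"
proof -
  have "F (lact (tensor M N) l A) = lact P l (F A)" if "A \<in> carr (tensor M N)" for A l
    using that by (induction rule: tensor_induct)
      (simp_all add: lact_tens lact_tensor_add lact_tensor_closed ab_homD[OF F] assms(3) left_modD[OF P])
  then show ?thesis using F by (simp add: left_hom_def)
qed

end

section \<open>Base change along a ring homomorphism\<close>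

lemma bimod_simps [simp]:
  "carr S_SS = UNIV" "addg S_SS = (+)" "zerog S_SS = 0" "lact S_SS = (*)" "ract S_SS = (*)"
  "carr (S_BS i) = UNIV" "addg (S_BS i) = (+)" "zerog (S_BS i) = 0" "lact (S_BS i) b s = i b * s"
  "ract (S_BS i) = (*)"
  "carr (S_SB i) = UNIV" "addg (S_SB i) = (+)" "zerog (S_SB i) = 0" "lact (S_SB i) = (*)"
  "ract (S_SB i) s b = s * i b"
  "carr (sub_BB i I) = I" "addg (sub_BB i I) = (+)" "zerog (sub_BB i I) = 0"
  "lact (sub_BB i I) b s = i b * s" "ract (sub_BB i I) s b = s * i b"
  "carr (restr i Y) = carr Y" "addg (restr i Y) = addg Y" "zerog (restr i Y) = zerog Y"
  "lact (restr i Y) = lact Y" "ract (restr i Y) x b = ract Y x (i b)"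
  by (simp_all add: S_SS_def S_BS_def S_SB_def sub_BB_def restr_def)

lemma ring_abelian: "abelian_grp S_SS"
  unfolding abelian_grp_def by (auto simp: algebra_simps intro: exI[of _ "- x" for x])

lemma abelian_grp_cong:
  assumes "carr G = carr H" "addg G = addg H" "zerog G = zerog H"
  shows "abelian_grp G = abelian_grp H"
  using assms by (simp add: abelian_grp_def)

lemma right_mod_S_SS: "right_mod S_SS" and left_mod_S_SS: "left_mod S_SS"
  using ring_abelian by (auto simp: right_mod_def left_mod_def algebra_simps)

text \<open>Moves a right module into the type over which \<open>comonadic\<close> quantifies.\<close>
definition copy :: "('a \<Rightarrow> 'c) \<Rightarrow> ('a,'l,'r,'z) bimod_scheme \<Rightarrow> ('c, unit, 'r) bimod" where
  "copy e M = \<lparr>carr = e ` carr M,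
     addg = (\<lambda>x y. e (addg M (the_inv_into (carr M) e x) (the_inv_into (carr M) e y))),
     zerog = e (zerog M), lact = (\<lambda>_ x. x),
     ract = (\<lambda>x r. e (ract M (the_inv_into (carr M) e x) r))\<rparr>"

locale module_copy =
  fixes e :: "'a \<Rightarrow> 'c" and M :: "('a,'l,'r::ring_1,'z) bimod_scheme"
  assumes inj: "inj_on e (carr M)" and right_M: "right_mod M"
begin

definition d where "d = the_inv_into (carr M) e"

lemma d_e: "x \<in> carr M \<Longrightarrow> d (e x) = x"
  unfolding d_def by (rule the_inv_into_f_f[OF inj])

lemma copy_simps:
  "carr (copy e M) = e ` carr M"
  "x \<in> carr M \<Longrightarrow> y \<in> carr M \<Longrightarrow> addg (copy e M) (e x) (e y) = e (addg M x y)"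
  "zerog (copy e M) = e (zerog M)"
  "x \<in> carr M \<Longrightarrow> ract (copy e M) (e x) r = e (ract M x r)"
  using d_e by (simp_all add: copy_def d_def)

lemma right_mod_copy: "right_mod (copy e M)"
  unfolding right_mod_def abelian_grp_def
  using right_modD[OF right_M] abelian_grpD(1,2,5)[OF right_modD(1)[OF right_M]]
    abelian_grpD(3,4,7)[OF right_modD(1)[OF right_M]]
  by (simp add: copy_simps) metis

lemma e_hom: "right_hom M (copy e M) e"
  unfolding right_hom_def ab_hom_def by (simp add: copy_simps)

lemma d_hom: "right_hom (copy e M) M d"
  unfolding right_hom_def ab_hom_def
  using right_modD(2)[OF right_M] abelian_grpD(2)[OF right_modD(1)[OF right_M]]
  by (simp add: copy_simps d_e Pi_iff)

end

locale ring_ext =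
  fixes i :: "'b::ring_1 \<Rightarrow> 's::ring_1"
  assumes hom: "ring_hom' i"
begin

lemma i_simps [simp]: "i 1 = 1" "i (a + b) = i a + i b" "i (a * b) = i a * i b"
  using hom by (simp_all add: ring_hom'_def)

lemma i_zero [simp]: "i 0 = 0"
  using i_simps(2)[of 0 0] by simp

lemma i_minus: "i (- a) = - i a"
  using i_simps(2)[of a "- a"] by (simp add: eq_neg_iff_add_eq_0 add.commute)

lemma right_mod_S_BS: "right_mod (S_BS i)" and left_mod_S_BS: "left_mod (S_BS i)"
  and right_mod_S_SB: "right_mod (S_SB i)" and left_mod_S_SB: "left_mod (S_SB i)"
  using ring_abelian abelian_grp_cong[of "S_BS i" S_SS] abelian_grp_cong[of "S_SB i" S_SS]
  by (auto simp: right_mod_def left_mod_def algebra_simps)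

lemma tens_pair_S_BS: "right_mod X \<Longrightarrow> tens_pair X (S_BS i)"
  unfolding tens_pair_def using right_mod_S_BS left_mod_S_BS by (simp add: mult.assoc)

lemma right_mod_restr: "right_mod Y \<Longrightarrow> right_mod (restr i Y)"
  using abelian_grp_cong[of "restr i Y" Y] by (simp add: right_mod_def)

abbreviation tS where "tS X x s \<equiv> tens X (S_BS i) x s"
abbreviation oS where "oS X \<equiv> tensor X (S_BS i)"
definition mapS where "mapS X X' f = tmap X (S_BS i) X' (S_BS i) f id"

lemma oS_induct [consumes 2, case_names tens add]:
  assumes "right_mod X" "A \<in> carr (oS X)"
    and "\<And>x s. x \<in> carr X \<Longrightarrow> Q (tS X x s)"
    and "\<And>A B. A \<in> carr (oS X) \<Longrightarrow> B \<in> carr (oS X) \<Longrightarrow> Q A \<Longrightarrow> Q B \<Longrightarrow> Q (addg (oS X) A B)"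
  shows "Q A"
  using assms by (intro tens_pair.tensor_induct[OF tens_pair_S_BS, of X A Q]) auto

lemma right_mod_oS: "right_mod X \<Longrightarrow> right_mod (oS X)"
  by (rule tens_pair.right_mod_tensor[OF tens_pair_S_BS])

lemma right_mod_restr_oS: "right_mod X \<Longrightarrow> right_mod (restr i (oS X))"
  by (intro right_mod_restr right_mod_oS)

lemma ab_oS: "right_mod X \<Longrightarrow> abelian_grp (oS X)"
  by (rule right_modD(1)[OF right_mod_oS])

lemma oS_simps:
  assumes "right_mod X"
  shows "x \<in> carr X \<Longrightarrow> tS X x s \<in> carr (oS X)"
    and "x \<in> carr X \<Longrightarrow> y \<in> carr X \<Longrightarrow> tS X (addg X x y) s = addg (oS X) (tS X x s) (tS X y s)"
    and "x \<in> carr X \<Longrightarrow> tS X x (s + t) = addg (oS X) (tS X x s) (tS X x t)"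
    and "x \<in> carr X \<Longrightarrow> tS X (ract X x b) s = tS X x (i b * s)"
    and "x \<in> carr X \<Longrightarrow> ract (oS X) (tS X x s) t = tS X x (s * t)"
    and "A \<in> carr (oS X) \<Longrightarrow> ract (oS X) A t \<in> carr (oS X)"
    and "A \<in> carr (oS X) \<Longrightarrow> B \<in> carr (oS X) \<Longrightarrow> addg (oS X) A B \<in> carr (oS X)"
    and "A \<in> carr (oS X) \<Longrightarrow> B \<in> carr (oS X) \<Longrightarrow>
      ract (oS X) (addg (oS X) A B) t = addg (oS X) (ract (oS X) A t) (ract (oS X) B t)"
proof -
  interpret tens_pair X "S_BS i" using assms by (rule tens_pair_S_BS)
  show "x \<in> carr X \<Longrightarrow> tS X x s \<in> carr (oS X)" by (simp add: tens_closed)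
  show "x \<in> carr X \<Longrightarrow> y \<in> carr X \<Longrightarrow> tS X (addg X x y) s = addg (oS X) (tS X x s) (tS X y s)"
    by (simp add: tens_add_left)
  show "x \<in> carr X \<Longrightarrow> tS X x (s + t) = addg (oS X) (tS X x s) (tS X x t)"
    using tens_add_right[of x s t] by simp
  show "x \<in> carr X \<Longrightarrow> tS X (ract X x b) s = tS X x (i b * s)"
    using tens_balanced[of x s b] by simp
  show "x \<in> carr X \<Longrightarrow> ract (oS X) (tS X x s) t = tS X x (s * t)"
    using ract_tens[of x s t] by simp
qed (use right_modD(2,3)[OF right_mod_oS[OF assms]] abelian_grpD(2)[OF ab_oS[OF assms]] in auto)

lemma tlift_oS:
  assumes X: "right_mod X" and P: "right_mod P"
    and h: "\<And>x s. x \<in> carr X \<Longrightarrow> h x s \<in> carr P"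
    "\<And>x y s. x \<in> carr X \<Longrightarrow> y \<in> carr X \<Longrightarrow> h (addg X x y) s = addg P (h x s) (h y s)"
    "\<And>x s t. x \<in> carr X \<Longrightarrow> h x (s + t) = addg P (h x s) (h x t)"
    "\<And>x s b. x \<in> carr X \<Longrightarrow> h (ract X x b) s = h x (i b * s)"
    "\<And>x s t. x \<in> carr X \<Longrightarrow> h x (s * t) = ract P (h x s) t"
  shows "tlift X (S_BS i) P h \<in> extensional (carr (oS X))"
    and "right_hom (oS X) P (tlift X (S_BS i) P h)"
    and "x \<in> carr X \<Longrightarrow> tlift X (S_BS i) P h (tS X x s) = h x s"
proof -
  interpret tens_pair X "S_BS i" using X by (rule tens_pair_S_BS)
  have bal: "balanced_map X (S_BS i) P h"
    unfolding balanced_map_def using h(1-4) by simp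
  note tl = tlift[OF right_modD(1)[OF P] bal]
  show "tlift X (S_BS i) P h \<in> extensional (carr (oS X))" by (rule tl)
  show tens: "x \<in> carr X \<Longrightarrow> tlift X (S_BS i) P h (tS X x s) = h x s" for x s by (simp add: tl)
  show "right_hom (oS X) P (tlift X (S_BS i) P h)"
    by (rule right_hom_tensorI[OF tl(2) P]) (simp add: tens h(5))
qed

lemma id_S_BS: "left_hom (S_BS i) (S_BS i) id" "right_hom (S_BS i) (S_BS i) id"
  by (simp_all add: left_hom_def right_hom_def ab_hom_def)

lemma mapS:
  assumes "right_mod X" "right_mod X'" "right_hom X X' f"
  shows mapS_hom: "right_hom (oS X) (oS X') (mapS X X' f)"
    and mapS_tS: "x \<in> carr X \<Longrightarrow> mapS X X' f (tS X x s) = tS X' (f x) s"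
  using tens_pair.tmap_right_hom[OF tens_pair_S_BS[OF assms(1)] tens_pair_S_BS[OF assms(2)] assms(3) id_S_BS]
    tens_pair.tmap_tens[OF tens_pair_S_BS[OF assms(1)] tens_pair_S_BS[OF assms(2)] assms(3) id_S_BS(1)]
  by (simp_all add: mapS_def)

lemma Kmor_mapS: "Kmor i X X' f = mapS X X' f"
  by (simp add: Kmor_def mapS_def)

text \<open>Functoriality. The composite is a separate \<open>h\<close> that has to agree with
  \<open>g\<close> after \<open>f\<close> on the carrier only, so restricted maps and inverses,
  which are arbitrary elsewhere, can be used directly.\<close>

lemma mapS_comp:
  assumes X: "right_mod X" "right_mod X'" "right_mod X''" and f: "right_hom X X' f" and g: "right_hom X' X'' g"
    and h: "right_hom X X'' h" and gf: "\<And>x. x \<in> carr X \<Longrightarrow> g (f x) = h x" and A: "A \<in> carr (oS X)"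
  shows "mapS X' X'' g (mapS X X' f A) = mapS X X'' h A"
  using X(1) A
proof (induction rule: oS_induct)
  case (tens x s)
  then show ?case using X f g h gf right_homD(2)[OF f] by (simp add: mapS_tS)
next
  case (add A B)
  note m = right_homD(2,3)[OF mapS_hom]
  show ?case using add m[OF X(1,2) f] m[OF X(2,3) g] m[OF X(1,3) h] by simp
qed

lemma mapS_id:
  assumes X: "right_mod X" and A: "A \<in> carr (oS X)" and f: "\<And>x. x \<in> carr X \<Longrightarrow> f x = x"
  shows "mapS X X f A = A"
proof -
  have fh: "right_hom X X f"
    using f right_modD(2)[OF X] abelian_grpD(2)[OF right_modD(1)[OF X]]
    by (simp add: right_hom_def ab_hom_def)
  show ?thesis using X A
  proof (induction rule: oS_induct)
    case (tens x s)
    then show ?case using f by (simp add: mapS_tS[OF X X fh])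
  next
    case (add A B)
    then show ?case using right_homD(3)[OF mapS_hom[OF X X fh]] by simp
  qed
qed

lemma right_hom_restr: "right_hom Y Y' f \<Longrightarrow> right_hom (restr i Y) (restr i Y') f"
  by (simp add: right_hom_def ab_hom_def)

lemma eta_hom: "right_mod X \<Longrightarrow> right_hom X (restr i (oS X)) (eta' i X)"
  unfolding right_hom_def ab_hom_def eta'_def by (simp add: oS_simps)

lemma Kcoact:
  assumes "right_mod X"
  shows Kcoact_hom: "right_hom (oS X) (oS (restr i (oS X))) (Kcoact i X)"
    and Kcoact_tS: "x \<in> carr X \<Longrightarrow> Kcoact i X (tS X x s) = tS (restr i (oS X)) (tS X x 1) s"
  using mapS[OF assms right_mod_restr_oS[OF assms] eta_hom[OF assms]]
  by (simp_all add: Kcoact_def Kobj_def eta'_def flip: mapS_def)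

end

locale comonadic_ext = ring_ext +
  assumes comon: "comonadic i"
begin

text \<open>Any injection of \<open>B\<close> into \<open>univ\<close> would do; the 0 merely fills
  the slot of \<open>S\<close>.\<close>

definition eB :: "'a \<Rightarrow> ('a, 'b) univ" where "eB b = {[(b, 0)]}"

sublocale B: module_copy eB "S_SS :: ('a,'a,'a) bimod"
  by unfold_locales (simp_all add: inj_on_def eB_def right_mod_S_SS)

abbreviation "B0 \<equiv> copy eB (S_SS :: ('a,'a,'a) bimod)"

lemma B0: "carr B0 = range eB" "B.d (eB b) = b"
  "addg B0 (eB a) (eB b) = eB (a + b)" "ract B0 (eB a) b = eB (a * b)"
  using B.copy_simps B.d_e by simp_all

text \<open>Full faithfulness against the regular module \<open>B\<close>: maps out of \<open>B\<close> are elements, comodule maps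
  out of \<open>B \<otimes> S\<close> are coinvariants.\<close>
lemma coinvariant_unit:
  fixes X :: "(('a, 'b) univ, unit, 'a) bimod"
  assumes X: "right_mod X" and A: "A \<in> carr (oS X)"
    and inv: "Kcoact i X A = tS (restr i (oS X)) A 1"
  shows "\<exists>x\<in>carr X. A = tS X x 1"
proof -
  note B = B.right_mod_copy and P = right_mod_oS[OF X]
  \<comment> \<open>The right \<open>S\<close>-linear map \<open>B \<otimes> S\<close> to
    \<open>X \<otimes> S\<close> that sends \<open>1 \<otimes> 1\<close> to \<open>A\<close>.
    Coinvariance of \<open>A\<close> is what makes it a map of comodules.\<close>
  let ?f = "tlift B0 (S_BS i) (oS X) (\<lambda>y s. ract (oS X) A (i (B.d y) * s))"
  have f: "?f \<in> extensional (carr (oS B0))" "right_hom (oS B0) (oS X) ?f"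
    and f_tS: "\<And>y s. y \<in> carr B0 \<Longrightarrow> ?f (tS B0 y s) = ract (oS X) A (i (B.d y) * s)"
    by (rule tlift_oS[OF B P];
      use A right_modD[OF P] in \<open>auto simp: B0 distrib_left distrib_right mult.assoc\<close>)+
  have Y: "right_mod (restr i (oS B0))" and PX: "right_mod (restr i (oS X))"
    by (intro right_mod_restr_oS B X)+
  note m = mapS[OF Y PX right_hom_restr[OF f(2)]]
  have co: "Kcoact i X (?f Z) = mapS (restr i (oS B0)) (restr i (oS X)) ?f (Kcoact i B0 Z)"
    if "Z \<in> carr (oS B0)" for Z
    using B that
  proof (induction rule: oS_induct)
    case (tens y s)
    have "Kcoact i X (?f (tS B0 y s)) = ract (oS (restr i (oS X))) (Kcoact i X A) (i (B.d y) * s)"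
      using f_tS[OF tens] right_homD(4)[OF Kcoact_hom[OF X] A] by simp
    also have "\<dots> = tS (restr i (oS X)) A (i (B.d y) * s)"
      using oS_simps(5)[OF PX, of A 1] A inv by simp
    also have "\<dots> = tS (restr i (oS X)) (ract (oS X) A (i (B.d y))) s"
      using oS_simps(4)[OF PX, of A "B.d y" s] A by simp
    also have "\<dots> = tS (restr i (oS X)) (?f (tS B0 y 1)) s"
      using f_tS[OF tens] by simp
    finally show ?case
      using m(2) oS_simps(1)[OF B tens] Kcoact_tS[OF B tens] by simp
  next
    case (add Z Z')
    then show ?case
      using right_homD(2,3)[OF f(2)] right_homD(2,3)[OF Kcoact_hom[OF X]] right_homD(2,3)[OF Kcoact_hom[OF B]]
        right_homD(3)[OF m(1)] by simp
  qed
  \<comment> \<open>Fullness of the comparison functor: \<open>?f\<close> comes from a linear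
    \<open>h\<close> out of \<open>B\<close>, and the element sought is the value of
    \<open>h\<close> at 1.\<close>
  have "bij_betw (Kmor i B0 X) (rhoms B0 X)
      {f. comod_hom i (Kobj i B0) (Kcoact i B0) (Kobj i X) (Kcoact i X) f}"
    using comon B X unfolding comonadic_def by blast
  moreover have "comod_hom i (Kobj i B0) (Kcoact i B0) (Kobj i X) (Kcoact i X) ?f"
    unfolding comod_hom_def Kobj_def mapS_def[symmetric] using f co by simp
  ultimately have "?f \<in> Kmor i B0 X ` rhoms B0 X"
    using bij_betw_imp_surj_on[of "Kmor i B0 X"] by (metis mem_Collect_eq)
  then obtain h where h: "?f = Kmor i B0 X h" "h \<in> rhoms B0 X"
    by (rule imageE)
  have hh: "right_hom B0 X h" using h(2) by (simp add: rhoms_def)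
  have 1: "eB 1 \<in> carr B0" by (simp add: B0)
  have "A = ?f (tS B0 (eB 1) 1)" using f_tS[OF 1] right_modD(6)[OF P A] by (simp add: B0)
  also have "\<dots> = tS X (h (eB 1)) 1"
    using mapS_tS[OF B X hh 1] h(1) by (simp add: Kmor_mapS)
  finally show ?thesis using right_homD(2)[OF hh 1] by blast
qed

end

section \<open>The map \<open>\<Gamma>'\<close>\<close>

lemma subprod_mult: "x \<in> I \<Longrightarrow> y \<in> J \<Longrightarrow> x * y \<in> subprod I J"
  unfolding subprod_def by (intro CollectI exI[of _ "[x]"] exI[of _ "[y]"]) auto

lemma subprod_add:
  assumes "z \<in> subprod I J" "z' \<in> subprod I J"
  shows "z + z' \<in> subprod I J"
proof -
  obtain xs ys xs' ys' where
    "length xs = length ys" "set xs \<subseteq> I" "set ys \<subseteq> J" "z = sum_list (map2 (*) xs ys)"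
    "length xs' = length ys'" "set xs' \<subseteq> I" "set ys' \<subseteq> J" "z' = sum_list (map2 (*) xs' ys')"
    using assms by (auto simp: subprod_def)
  then show ?thesis
    unfolding subprod_def by (intro CollectI exI[of _ "xs @ xs'"] exI[of _ "ys @ ys'"]) auto
qed

text \<open>With 0 in both factors the empty sum is the product \<open>0 * 0\<close>, so no separate
  case for zero arises.\<close>

lemma subprod_induct [consumes 3, case_names mult add]:
  assumes "z \<in> subprod I J" and zero: "0 \<in> I" "0 \<in> J"
    and mult: "\<And>x y. x \<in> I \<Longrightarrow> y \<in> J \<Longrightarrow> Q (x * y)"
    and add: "\<And>z z'. Q z \<Longrightarrow> Q z' \<Longrightarrow> Q (z + z')"
  shows "Q z"
proof -
  obtain xs ys where xy: "length xs = length ys" "set xs \<subseteq> I" "set ys \<subseteq> J"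
    and z: "z = sum_list (map2 (*) xs ys)"
    using assms(1) by (auto simp: subprod_def)
  from xy have "Q (sum_list (map2 (*) xs ys))"
  proof (induction xs ys rule: list_induct2)
    case Nil
    then show ?case using mult[OF zero] by simp
  qed (simp add: mult add)
  then show ?thesis using z by simp
qed

lemma subprod_subbimods:
  assumes I: "I \<in> subbimods i" and J: "J \<in> subbimods i"
  shows "subprod I J \<in> subbimods i"
proof -
  have 0: "0 \<in> I" "0 \<in> J" using I J by (auto simp: subbimods_def)
  have "- z \<in> subprod I J \<and> i b * z \<in> subprod I J \<and> z * i b \<in> subprod I J" if "z \<in> subprod I J" for z b
    using that 0
  proof (induction rule: subprod_induct)
    case (mult x y)
    have "- x \<in> I" "i b * x \<in> I" "y * i b \<in> J"
      using mult I J by (auto simp: subbimods_def)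
    then show ?case
      using subprod_mult[of "- x" I y J] subprod_mult[of "i b * x" I y J] subprod_mult[of x I "y * i b" J] mult
      by (simp add: mult.assoc)
  next
    case (add z z')
    then show ?case using subprod_add[of "- z" I J "- z'"] by (simp add: subprod_add distrib_left distrib_right)
  qed
  moreover have "0 \<in> subprod I J" using subprod_mult[OF 0] by simp
  ultimately show ?thesis by (auto simp: subbimods_def subprod_add)
qed

section \<open>The Sweedler coring and its bimodule maps\<close>

context ring_ext
begin

lemma left_tens_pair_S_SB: "left_tens_pair (S_SB i) (S_BS i)"
  unfolding left_tens_pair_def left_tens_pair_axioms_def
  using tens_pair_S_BS[OF right_mod_S_SB] left_mod_S_SB by (simp add: mult.assoc)

sublocale SS: left_tens_pair "S_SB i" "S_BS i"
  by (rule left_tens_pair_S_SB)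

lemma sweedler_eq: "oS (S_SB i) = sweedler i"
  by (simp add: sweedler_def)

abbreviation T where "T \<equiv> sweedler i"
abbreviation tT where "tT s t \<equiv> tens (S_SB i) (S_BS i) s t"

lemmas left_mod_T = SS.left_mod_tensor[unfolded sweedler_eq]
  and right_mod_T = SS.right_mod_tensor[unfolded sweedler_eq]

lemma T_simps:
  "tT s t \<in> carr T" "tT (s * i b) t = tT s (i b * t)"
  "tT (s + s') t = addg T (tT s t) (tT s' t)" "tT s (t + t') = addg T (tT s t) (tT s t')"
  "lact T r (tT s t) = tT (r * s) t" "ract T (tT s t) r = tT s (t * r)"
  using oS_simps[OF right_mod_S_SB] SS.lact_tens by (simp_all add: sweedler_eq)

lemma T_induct [consumes 1, case_names tens add]:
  assumes "A \<in> carr T" "\<And>s t. Q (tT s t)"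
    "\<And>A B. A \<in> carr T \<Longrightarrow> B \<in> carr T \<Longrightarrow> Q A \<Longrightarrow> Q B \<Longrightarrow> Q (addg T A B)"
  shows "Q A"
  using oS_induct[OF right_mod_S_SB, of A Q] assms by (simp add: sweedler_eq)

text \<open>Here the balancing is over \<open>S\<close> and no longer over \<open>B\<close>; this
  tensor product is the target of the comultiplication.\<close>

sublocale TT: left_tens_pair T T
  unfolding left_tens_pair_def left_tens_pair_axioms_def tens_pair_def
  using left_mod_T right_mod_T SS.lact_ract_tensor by (simp add: sweedler_eq)

lemma counit:
  shows counit_left: "left_hom T S_SS (counit i)"
    and counit_right: "right_hom T S_SS (counit i)"
    and counit_tT: "counit i (tT s t) = s * t"
proof -
  have t: "counit i (tT s t) = s * t" for s t
    unfolding counit_def by (rule tlift_oS[OF right_mod_S_SB right_mod_S_SS]) (simp_all add: algebra_simps)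
  have r: "right_hom T S_SS (counit i)"
    unfolding counit_def sweedler_eq[symmetric]
    by (rule tlift_oS[OF right_mod_S_SB right_mod_S_SS]) (simp_all add: algebra_simps)
  show "counit i (tT s t) = s * t" "right_hom T S_SS (counit i)" by (rule t r)+
  show "left_hom T S_SS (counit i)"
    using SS.left_hom_tensorI[of S_SS "counit i"] right_homD(1)[OF r] left_mod_S_SS t
    by (simp add: sweedler_eq mult.assoc)
qed

lemma comult:
  shows comult_left: "left_hom T (tensor T T) (comult i)"
    and comult_right: "right_hom T (tensor T T) (comult i)"
    and comult_tT: "comult i (tT s t) = tens T T (tT s 1) (tT 1 t)"
proof -
  let ?\<phi> = "\<lambda>(s, s'). (tT s 1, tT 1 s')"
  have \<phi>: "?\<phi> \<in> carr (S_SB i) \<times> carr (S_BS i) \<rightarrow> carr T \<times> carr T" by (auto simp: T_simps)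
  have bal: "balanced_map (S_SB i) (S_BS i) (tensor T T)
      (\<lambda>x y. tens T T (fst (?\<phi> (x, y))) (snd (?\<phi> (x, y))))"
    unfolding balanced_map_def
  proof (intro conjI ballI allI)
    \<comment> \<open>The scalar \<open>i b\<close> crosses three tensor signs: out of
      \<open>x\<close> to the right end of the first factor, over the outer sign as an element of
      \<open>S\<close>, and then into \<open>y\<close>.\<close>
    show "tens T T (fst (?\<phi> (ract (S_SB i) x b, y))) (snd (?\<phi> (ract (S_SB i) x b, y))) =
        tens T T (fst (?\<phi> (x, lact (S_BS i) b y))) (snd (?\<phi> (x, lact (S_BS i) b y)))" for x y b
      using TT.tens_balanced[of "tT x 1" "tT 1 y" "i b"] T_simps(2)[of x b 1] T_simps(2)[of 1 b y]
      by (simp add: T_simps(1,5,6))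
  qed (simp_all add: T_simps TT.tens_closed TT.tens_add_left TT.tens_add_right)
  note ti = SS.tinduce[OF TT.tens_pair_axioms \<phi> bal, folded comult_def, unfolded sweedler_eq]
  show t: "comult i (tT s t) = tens T T (tT s 1) (tT 1 t)" for s t
    using ti(2)[of s t] by simp
  show "left_hom T (tensor T T) (comult i)"
    by (rule SS.left_hom_tensorI[unfolded sweedler_eq, OF ti(1) TT.left_mod_tensor])
      (simp add: t TT.lact_tens T_simps)
  show "right_hom T (tensor T T) (comult i)"
    by (rule SS.right_hom_tensorI[unfolded sweedler_eq, OF ti(1) TT.right_mod_tensor])
      (simp add: t TT.ract_tens T_simps)
qed

text \<open>If \<open>I S = S\<close>, right multiplication turns the elements
  \<open>1 \<otimes> x\<close> with \<open>x\<close> in \<open>I\<close> into all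
  \<open>1 \<otimes> s\<close>, and left multiplication then gives all pure tensors. So these
  elements generate \<open>T\<close> as a bimodule.\<close>

lemma T_hom_eqI:
  assumes f: "left_hom T P f" "right_hom T P f" and g: "left_hom T P g" "right_hom T P g"
    and eq: "\<And>x. x \<in> I \<Longrightarrow> f (tT 1 x) = g (tT 1 x)"
    and I0: "0 \<in> I" and gen: "\<And>s. s \<in> subprod I UNIV" and A: "A \<in> carr T"
  shows "f A = g A"
proof -
  have 1: "f (tT 1 s) = g (tT 1 s)" for s
    using gen[of s] I0 UNIV_I
  proof (induction rule: subprod_induct)
    case (mult x y)
    have "f (ract T (tT 1 x) y) = g (ract T (tT 1 x) y)"
      using mult eq right_homD(4)[OF f(2)] right_homD(4)[OF g(2)] by (simp add: T_simps(1))
    then show ?case by (simp add: T_simps)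
  next
    case (add x y)
    then show ?case using right_homD(3)[OF f(2)] right_homD(3)[OF g(2)] by (simp add: T_simps)
  qed
  show ?thesis using A
  proof (induction rule: T_induct)
    case (tens s t)
    have "f (lact T s (tT 1 t)) = g (lact T s (tT 1 t))"
      using left_homD(4)[OF f(1)] left_homD(4)[OF g(1)] 1 by (simp add: T_simps(1))
    then show ?case by (simp add: T_simps)
  next
    case (add A B)
    then show ?case using left_homD(3)[OF f(1)] left_homD(3)[OF g(1)] by simp
  qed
qed

section \<open>Subbimodules and the multiplication map \<open>mr\<close>\<close>

lemma subbimodsD:
  assumes "I \<in> subbimods i"
  shows "0 \<in> I" "x \<in> I \<Longrightarrow> y \<in> I \<Longrightarrow> x + y \<in> I" "x \<in> I \<Longrightarrow> - x \<in> I"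
    "x \<in> I \<Longrightarrow> i b * x \<in> I" "x \<in> I \<Longrightarrow> x * i b \<in> I"
  using assms by (auto simp: subbimods_def)

lemma left_tens_pair_sub:
  assumes I: "I \<in> subbimods i"
  shows "left_tens_pair (sub_BB i I) (S_BS i)"
proof -
  note D = subbimodsD[OF I]
  have ab: "abelian_grp (sub_BB i I)"
    unfolding abelian_grp_def
  proof (intro conjI ballI)
    show "\<exists>y\<in>carr (sub_BB i I). addg (sub_BB i I) x y = zerog (sub_BB i I)" if "x \<in> carr (sub_BB i I)" for x
      using D that by (auto intro!: bexI[of _ "- x"])
  qed (use D in \<open>auto simp: algebra_simps\<close>)
  have "right_mod (sub_BB i I)" "left_mod (sub_BB i I)"
    using ab D by (auto simp: right_mod_def left_mod_def algebra_simps)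
  then show ?thesis
    unfolding left_tens_pair_def left_tens_pair_axioms_def
    using tens_pair_S_BS by (simp add: mult.assoc)
qed

lemma right_mod_sub: "I \<in> subbimods i \<Longrightarrow> right_mod (sub_BB i I)"
  using left_tens_pair_sub by (simp add: left_tens_pair_def tens_pair_def)

lemma mr:
  assumes I: "I \<in> subbimods i"
  shows mr_hom: "right_hom (oS (sub_BB i I)) S_SS (mr i I)"
    and mr_tS: "x \<in> I \<Longrightarrow> mr i I (tS (sub_BB i I) x s) = x * s"
  unfolding mr_def
  by (rule tlift_oS[OF right_mod_sub[OF I] right_mod_S_SS]; simp add: algebra_simps)+

text \<open>Left \<open>B\<close>-linearity passes to the inverse \<open>minv\<close>, and there it
  makes the defining formula of \<open>Gamma'\<close> balanced.\<close>

lemma mr_left: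
  assumes I: "I \<in> subbimods i" and A: "A \<in> carr (oS (sub_BB i I))"
  shows "mr i I (lact (oS (sub_BB i I)) b A) = i b * mr i I A"
proof -
  interpret L: left_tens_pair "sub_BB i I" "S_BS i" by (rule left_tens_pair_sub[OF I])
  show ?thesis
    using right_mod_sub[OF I] A
  proof (induction rule: oS_induct)
    case (tens x s)
    then show ?case using mr_tS[OF I] subbimodsD(4)[OF I] by (simp add: L.lact_tens mult.assoc)
  next
    case (add A B)
    then show ?case using right_homD(3)[OF mr_hom[OF I]]
      by (simp add: L.lact_tensor_add L.lact_tensor_closed distrib_left)
  qed
qed

lemma IrI:
  assumes I: "I \<in> subbimods i"
    and F: "\<And>s. F s \<in> carr (oS (sub_BB i I))" "\<And>s. mr i I (F s) = s"
    "\<And>A. A \<in> carr (oS (sub_BB i I)) \<Longrightarrow> F (mr i I A) = A"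
  shows "I \<in> Ir i"
proof -
  have "bij_betw (mr i I) (carr (oS (sub_BB i I))) UNIV"
    by (rule bij_betw_byWitness[of _ F]) (use F in auto)
  then show ?thesis using mr_hom[OF I] I by (simp add: Ir_def)
qed

definition minv where "minv I = the_inv_into (carr (oS (sub_BB i I))) (mr i I)"

lemma Ir_subbimods: "I \<in> Ir i \<Longrightarrow> I \<in> subbimods i"
  by (simp add: Ir_def)

lemma minv:
  assumes "I \<in> Ir i"
  shows minv_carr: "minv I s \<in> carr (oS (sub_BB i I))"
    and mr_minv: "mr i I (minv I s) = s"
    and minv_mr: "A \<in> carr (oS (sub_BB i I)) \<Longrightarrow> minv I (mr i I A) = A"
proof -
  have b: "bij_betw (mr i I) (carr (oS (sub_BB i I))) UNIV" using assms by (simp add: Ir_def)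
  then have inj: "inj_on (mr i I) (carr (oS (sub_BB i I)))" and im: "s \<in> mr i I ` carr (oS (sub_BB i I))" for s
    by (auto simp: bij_betw_def)
  show "minv I s \<in> carr (oS (sub_BB i I))"
    unfolding minv_def by (rule the_inv_into_into[OF inj im subset_refl])
  show "mr i I (minv I s) = s" unfolding minv_def by (rule f_the_inv_into_f[OF inj im])
  show "A \<in> carr (oS (sub_BB i I)) \<Longrightarrow> minv I (mr i I A) = A"
    unfolding minv_def by (rule the_inv_into_f_f[OF inj])
qed

lemma minv_simps:
  assumes I: "I \<in> Ir i"
  shows "minv I (s + t) = addg (oS (sub_BB i I)) (minv I s) (minv I t)"
    and "minv I (s * t) = ract (oS (sub_BB i I)) (minv I s) t"
    and "minv I (i b * s) = lact (oS (sub_BB i I)) b (minv I s)"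
    and "x \<in> I \<Longrightarrow> minv I (x * s) = tS (sub_BB i I) x s"
proof -
  note J = Ir_subbimods[OF I]
  interpret L: left_tens_pair "sub_BB i I" "S_BS i" by (rule left_tens_pair_sub[OF J])
  note m = minv[OF I] and h = right_homD[OF mr_hom[OF J]] and c = oS_simps[OF right_mod_sub[OF J]]
  show "minv I (s + t) = addg (oS (sub_BB i I)) (minv I s) (minv I t)"
    using h(3)[of "minv I s" "minv I t"] m(3)[of "addg (oS (sub_BB i I)) (minv I s) (minv I t)"] c(7) m(1,2)
    by simp
  show "minv I (s * t) = ract (oS (sub_BB i I)) (minv I s) t"
    using h(4)[of "minv I s" t] m(3)[of "ract (oS (sub_BB i I)) (minv I s) t"] c(6) m(1,2)
    by simp
  show "minv I (i b * s) = lact (oS (sub_BB i I)) b (minv I s)"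
    using mr_left[OF J, of "minv I s" b] m(3)[of "lact (oS (sub_BB i I)) b (minv I s)"]
      L.lact_tensor_closed m(1,2) by simp
  show "x \<in> I \<Longrightarrow> minv I (x * s) = tS (sub_BB i I) x s"
    using mr_tS[OF J, of x s] m(3)[of "tS (sub_BB i I) x s"] c(1)[of x s] by simp
qed

text \<open>Surjectivity of \<open>mr i I\<close>, read as \<open>I S = S\<close>: the generation
  hypothesis of \<open>T_hom_eqI\<close>.\<close>

lemma Ir_generates:
  assumes I: "I \<in> Ir i"
  shows "s \<in> subprod I UNIV"
proof -
  note J = Ir_subbimods[OF I]
  have "mr i I A \<in> subprod I UNIV" if "A \<in> carr (oS (sub_BB i I))" for A
    using right_mod_sub[OF J] that
  proof (induction rule: oS_induct)
    case (tens x s)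
    then show ?case using mr_tS[OF J] by (simp add: subprod_mult)
  next
    case (add A B)
    then show ?case using right_homD(3)[OF mr_hom[OF J]] by (simp add: subprod_add)
  qed
  from this[OF minv_carr[OF I, of s]] show ?thesis by (simp add: mr_minv[OF I])
qed

section \<open>The map \<open>Gamma'\<close> as a homomorphism of corings\<close>

lemma mult_hom:
  assumes "\<And>x. x \<in> I \<Longrightarrow> s * x \<in> J"
  shows "right_hom (sub_BB i I) (sub_BB i J) ((*) s)" "right_hom (sub_BB i I) (S_SB i) ((*) s)"
  using assms by (auto simp: right_hom_def ab_hom_def algebra_simps)

text \<open>The map \<open>\<nu>_I \<otimes> S\<close> with its first argument frozen at
  \<open>s\<close>; in this way the threefold tensor product
  \<open>S \<otimes> I \<otimes> S\<close> is never formed.\<close>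

abbreviation \<nu> where "\<nu> I s \<equiv> mapS (sub_BB i I) (S_SB i) ((*) s)"

lemma \<nu>:
  assumes I: "I \<in> subbimods i"
  shows \<nu>_hom: "right_hom (oS (sub_BB i I)) T (\<nu> I s)"
    and \<nu>_tS: "x \<in> I \<Longrightarrow> \<nu> I s (tS (sub_BB i I) x t) = tT (s * x) t"
  using mapS[OF right_mod_sub[OF I] right_mod_S_SB mult_hom(2)[of I s UNIV]] by (simp_all add: sweedler_eq)

text \<open>Together with \<open>minv_simps\<close>, the first two identities make
  \<open>\<nu> I s (minv I t)\<close> balanced in \<open>s\<close> and \<open>t\<close>, as
  \<open>tlift\<close> requires; the third yields left linearity of \<open>Gamma'\<close>.\<close>

lemma \<nu>_simps:
  assumes I: "I \<in> subbimods i" and A: "A \<in> carr (oS (sub_BB i I))"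
  shows "\<nu> I (s + t) A = addg T (\<nu> I s A) (\<nu> I t A)"
    and "\<nu> I (s * i b) A = \<nu> I s (lact (oS (sub_BB i I)) b A)"
    and "\<nu> I (r * s) A = lact T r (\<nu> I s A)"
proof -
  interpret L: left_tens_pair "sub_BB i I" "S_BS i" by (rule left_tens_pair_sub[OF I])
  note h = right_homD(2,3)[OF \<nu>_hom[OF I]] and t = \<nu>_tS[OF I]
  note lT = left_modD[OF left_mod_T] and aT = abelian_grpD(2)[OF left_modD(1)[OF left_mod_T]]
  show "\<nu> I (s + t) A = addg T (\<nu> I s A) (\<nu> I t A)"
    using right_mod_sub[OF I] A
  proof (induction rule: oS_induct)
    case (add A B)
    then show ?case by (simp add: h addg_swap[OF left_modD(1)[OF left_mod_T]] aT)
  qed (simp only: t bimod_simps, simp only: T_simps distrib_right)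
  show "\<nu> I (s * i b) A = \<nu> I s (lact (oS (sub_BB i I)) b A)"
    using right_mod_sub[OF I] A
  proof (induction rule: oS_induct)
    case (add A B)
    then show ?case by (simp add: h L.lact_tensor_add L.lact_tensor_closed)
  qed (simp only: t L.lact_tens subbimodsD(4)[OF I] bimod_simps UNIV_I, simp only: mult.assoc)
  show "\<nu> I (r * s) A = lact T r (\<nu> I s A)"
    using right_mod_sub[OF I] A
  proof (induction rule: oS_induct)
    case (add A B)
    then show ?case by (simp add: h lT)
  qed (simp only: t bimod_simps, simp only: T_simps mult.assoc)
qed

lemma Gamma':
  assumes I: "I \<in> Ir i"
  shows Gamma'_ext: "Gamma' i I \<in> extensional (carr T)"
    and Gamma'_left: "left_hom T T (Gamma' i I)"
    and Gamma'_right: "right_hom T T (Gamma' i I)"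
    and Gamma'_tT: "Gamma' i I (tT s t) = \<nu> I s (minv I t)"
proof -
  note J = Ir_subbimods[OF I]
  have G: "Gamma' i I = tlift (S_SB i) (S_BS i) T (\<lambda>s t. \<nu> I s (minv I t))"
    unfolding Gamma'_def minv_def mapS_def ..
  note tl = tlift_oS[OF right_mod_S_SB right_mod_T, of "\<lambda>s t. \<nu> I s (minv I t)", folded G, unfolded sweedler_eq]
  note h = right_homD[OF \<nu>_hom[OF J]] and m = minv_carr[OF I] and ms = minv_simps[OF I]
  have b: "\<nu> I (s * i b) (minv I t) = \<nu> I s (minv I (i b * t))" for s b t
    unfolding ms(3) by (rule \<nu>_simps(2)[OF J m])
  have rs: "\<nu> I s (minv I (t * u)) = ract T (\<nu> I s (minv I t)) u" for s t u
    unfolding ms(2) by (rule h(4)[OF m])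
  show "Gamma' i I \<in> extensional (carr T)" and r: "right_hom T T (Gamma' i I)"
    and t: "Gamma' i I (tT s t) = \<nu> I s (minv I t)" for s t
    by (rule tl; simp add: h m b rs ms(1) \<nu>_simps(1)[OF J])+
  show "left_hom T T (Gamma' i I)"
    by (rule SS.left_hom_tensorI[unfolded sweedler_eq, OF right_homD(1)[OF r] left_mod_T])
      (simp add: t \<nu>_simps(3)[OF J] m)
qed

text \<open>For \<open>x\<close> in \<open>I\<close> the preimage of \<open>x = x * 1\<close> under
  \<open>mr i I\<close> is \<open>x \<otimes> 1\<close>.\<close>

lemma Gamma'_unit:
  assumes I: "I \<in> Ir i" and x: "x \<in> I"
  shows "Gamma' i I (tT 1 x) = tT x 1"
  using minv_simps(4)[OF I x, of 1] \<nu>_tS[OF Ir_subbimods[OF I] x] by (simp add: Gamma'_tT[OF I])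

text \<open>The uniqueness half of the characterisation. It is applied to the identity, to a
  composite \<open>Gamma' i J\<close> after \<open>Gamma' i I\<close>, and to a given coring
  endomorphism.\<close>

lemma Gamma'_eqI:
  assumes I: "I \<in> Ir i" and g: "g \<in> extensional (carr T)" "left_hom T T g" "right_hom T T g"
    and eq: "\<And>x. x \<in> I \<Longrightarrow> g (tT 1 x) = tT x 1"
  shows "Gamma' i I = g"
proof (rule extensionalityI[OF Gamma'_ext[OF I] g(1)])
  show "Gamma' i I A = g A" if "A \<in> carr T" for A
    by (rule T_hom_eqI[OF Gamma'_left[OF I] Gamma'_right[OF I] g(2,3) _
        subbimodsD(1)[OF Ir_subbimods[OF I]] Ir_generates[OF I] that])
      (simp add: Gamma'_unit[OF I] eq)
qed

lemma left_hom_comp: "left_hom M N f \<Longrightarrow> left_hom N P g \<Longrightarrow> left_hom M P (\<lambda>x. g (f x))"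
  and right_hom_comp: "right_hom M' N' f \<Longrightarrow> right_hom N' P' g \<Longrightarrow> right_hom M' P' (\<lambda>x. g (f x))"
  by (auto simp: left_hom_def right_hom_def ab_hom_def Pi_iff)

lemma tmap_TT:
  assumes g: "left_hom T T g" "right_hom T T g"
  shows "left_hom (tensor T T) (tensor T T) (tmap T T T T g g)"
    and "right_hom (tensor T T) (tensor T T) (tmap T T T T g g)"
    and "A \<in> carr T \<Longrightarrow> B \<in> carr T \<Longrightarrow> tmap T T T T g g (tens T T A B) = tens T T (g A) (g B)"
proof -
  note t = TT.tmap[OF TT.tens_pair_axioms g(2,1)]
  show "right_hom (tensor T T) (tensor T T) (tmap T T T T g g)"
    by (rule TT.tmap_right_hom[OF TT.tens_pair_axioms g(2,1,2)])
  show "left_hom (tensor T T) (tensor T T) (tmap T T T T g g)"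
    by (rule TT.left_hom_tensorI[OF t(1) TT.left_mod_tensor])
      (simp add: t(2) left_homD[OF g(1)] left_modD(2)[OF left_mod_T] TT.lact_tens)
  show "A \<in> carr T \<Longrightarrow> B \<in> carr T \<Longrightarrow> tmap T T T T g g (tens T T A B) = tens T T (g A) (g B)"
    by (rule t(2))
qed

text \<open>Each compatibility equates two bimodule maps out of \<open>T\<close>, so it only has to
  be tested on the elements \<open>1 \<otimes> x\<close> with \<open>x\<close> in
  \<open>I\<close>.\<close>

lemma Gamma'_End_cor:
  assumes I: "I \<in> Ir i"
  shows "Gamma' i I \<in> End_cor i"
proof -
  let ?g = "Gamma' i I"
  note g = Gamma'_left[OF I] Gamma'_right[OF I] and u = Gamma'_unit[OF I]
  note eqI = T_hom_eqI[OF _ _ _ _ _ subbimodsD(1)[OF Ir_subbimods[OF I]] Ir_generates[OF I]]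
  have "counit i (?g A) = counit i A" if "A \<in> carr T" for A
    by (rule eqI[OF left_hom_comp[OF g(1) counit_left] right_hom_comp[OF g(2) counit_right]
        counit_left counit_right _ that]) (simp add: u counit_tT)
  moreover have "comult i (?g A) = tmap T T T T ?g ?g (comult i A)" if "A \<in> carr T" for A
  proof (rule eqI[OF left_hom_comp[OF g(1) comult_left] right_hom_comp[OF g(2) comult_right]
        left_hom_comp[OF comult_left tmap_TT(1)[OF g]] right_hom_comp[OF comult_right tmap_TT(2)[OF g]] _ that])
    fix x assume x: "x \<in> I"
    \<comment> \<open>The value of \<open>?g\<close> at \<open>1 \<otimes> 1\<close> is unknown, but
      \<open>x\<close> can be moved over the outer tensor sign to it, and
      \<open>?g (1 \<otimes> 1)\<close> times \<open>x\<close> is \<open>?g (1 \<otimes> x)\<close>,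
      which is \<open>x \<otimes> 1\<close>.\<close>
    have "tmap T T T T ?g ?g (comult i (tT 1 x)) = tens T T (?g (tT 1 1)) (lact T x (tT 1 1))"
      using x by (simp add: comult_tT tmap_TT(3)[OF g] T_simps u)
    also have "\<dots> = tens T T (ract T (?g (tT 1 1)) x) (tT 1 1)"
      by (rule TT.tens_balanced[symmetric]) (simp_all add: T_simps left_homD[OF g(1)])
    also have "ract T (?g (tT 1 1)) x = ?g (tT 1 x)"
      using right_homD(4)[OF g(2), of "tT 1 1" x] by (simp add: T_simps)
    also have "tens T T (?g (tT 1 x)) (tT 1 1) = comult i (?g (tT 1 x))"
      using x by (simp add: u comult_tT)
    finally show "comult i (?g (tT 1 x)) = tmap T T T T ?g ?g (comult i (tT 1 x))" by simp
  qed
  ultimately show ?thesis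
    unfolding End_cor_def using g Gamma'_ext[OF I] by simp
qed

text \<open>The unit of the monoid. Every \<open>i b \<otimes> s\<close> equals
  \<open>1 \<otimes> i b * s\<close>, so sending \<open>s\<close> to \<open>1 \<otimes> s\<close>
  inverts the multiplication map, whether or not \<open>i\<close> is injective.\<close>

lemma range_Ir: "range i \<in> Ir i"
proof -
  have I: "range i \<in> subbimods i"
    by (auto simp: subbimods_def image_iff simp flip: i_simps(2,3) i_minus i_zero)
  note c = oS_simps[OF right_mod_sub[OF I]]
  have 1: "1 \<in> range i" using i_simps(1) by (metis rangeI)
  show ?thesis
  proof (rule IrI[OF I, of "tS (sub_BB i (range i)) 1"])
    show "tS (sub_BB i (range i)) 1 s \<in> carr (oS (sub_BB i (range i)))" for s using c(1) 1 by simp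
    show "mr i (range i) (tS (sub_BB i (range i)) 1 s) = s" for s using mr_tS[OF I 1] by simp
    show "tS (sub_BB i (range i)) 1 (mr i (range i) A) = A" if "A \<in> carr (oS (sub_BB i (range i)))" for A
      using right_mod_sub[OF I] that
    proof (induction rule: oS_induct)
      case (tens x s)
      then obtain b where "x = i b" by auto
      then show ?case using c(4)[of 1 b s] mr_tS[OF I, of x s] 1 by simp
    next
      case (add A B)
      then show ?case using right_homD(3)[OF mr_hom[OF I]] c(3) 1 by simp
    qed
  qed
qed

lemma Gamma'_range: "Gamma' i (range i) = restrict id (carr T)"
proof (rule Gamma'_eqI[OF range_Ir])
  note T = left_modD[OF left_mod_T] right_modD[OF right_mod_T]
  show "left_hom T T (restrict id (carr T))" "right_hom T T (restrict id (carr T))"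
    using T abelian_grpD(2)[OF T(1)] by (simp_all add: left_hom_def right_hom_def ab_hom_def)
  show "restrict id (carr T) (tT 1 x) = tT x 1" if "x \<in> range i" for x
    using that T_simps(2)[of 1 _ 1] by (auto simp: T_simps(1))
qed simp

text \<open>The inverse is the composite of \<open>S\<close> to \<open>I \<otimes> S\<close>, then
  to \<open>I \<otimes> J \<otimes> S\<close>, then to \<open>I J \<otimes> S\<close>: decompose
  along \<open>I\<close>, decompose the right factor along \<open>J\<close>, multiply the two left
  factors.\<close>

lemma subprod_Ir:
  assumes I: "I \<in> Ir i" and J: "J \<in> Ir i"
  shows "subprod I J \<in> Ir i"
proof -
  let ?K = "subprod I J"
  note I' = Ir_subbimods[OF I] and J' = Ir_subbimods[OF J]
  have K: "?K \<in> subbimods i" by (rule subprod_subbimods[OF I' J'])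
  have c0: "\<And>x. x \<in> I \<Longrightarrow> right_hom (sub_BB i J) (sub_BB i ?K) ((*) x)"
    by (rule mult_hom) (rule subprod_mult)
  let ?\<mu> = "\<lambda>x. mapS (sub_BB i J) (sub_BB i ?K) ((*) x)"
  note \<mu> = mapS[OF right_mod_sub[OF J'] right_mod_sub[OF K] c0]
  note \<mu>h = right_homD[OF \<mu>(1)]
  interpret LJ: left_tens_pair "sub_BB i J" "S_BS i" by (rule left_tens_pair_sub[OF J'])
  note c = oS_simps[OF right_mod_sub[OF K]] and ab = ab_oS[OF right_mod_sub[OF K]]
  have add: "?\<mu> (x + y) A = addg (oS (sub_BB i ?K)) (?\<mu> x A) (?\<mu> y A)"
    if "x \<in> I" "y \<in> I" "A \<in> carr (oS (sub_BB i J))" for x y A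
    using right_mod_sub[OF J'] that(3)
  proof (induction rule: oS_induct)
    case (tens z s)
    then show ?case using that(1,2) subbimodsD(2)[OF I'] c(2)[of "x * z" "y * z" s]
      by (simp add: \<mu>(2) distrib_right[of x y z] subprod_mult)
  next
    case (add A B)
    then show ?case using that(1,2) subbimodsD(2)[OF I']
      by (simp add: \<mu>h(2,3) addg_swap[OF ab] c(7))
  qed
  have bal: "?\<mu> (x * i b) A = ?\<mu> x (lact (oS (sub_BB i J)) b A)"
    if "x \<in> I" "A \<in> carr (oS (sub_BB i J))" for x b A
    using right_mod_sub[OF J'] that(2)
  proof (induction rule: oS_induct)
    case (tens z s)
    then show ?case using that(1) subbimodsD(5)[OF I'] subbimodsD(4)[OF J']
      by (simp add: \<mu>(2) LJ.lact_tens mult.assoc[of x "i b" z])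
  next
    case (add A B)
    then show ?case using that(1) subbimodsD(5)[OF I']
      by (simp add: \<mu>h(3) LJ.lact_tensor_add LJ.lact_tensor_closed)
  qed
  \<comment> \<open>The last two stages in one: if \<open>minv J s\<close> is a sum of terms
    \<open>y \<otimes> t\<close>, then \<open>x \<otimes> s\<close> goes to the sum of the terms
    \<open>x * y \<otimes> t\<close>.\<close>
  define G where "G = tlift (sub_BB i I) (S_BS i) (oS (sub_BB i ?K)) (\<lambda>x s. ?\<mu> x (minv J s))"
  note tl = tlift_oS[OF right_mod_sub[OF I'] right_mod_oS[OF right_mod_sub[OF K]],
      of "\<lambda>x s. ?\<mu> x (minv J s)", folded G_def]
  note mJ = minv_carr[OF J] minv_simps[OF J]
  have b: "?\<mu> (x * i b) (minv J s) = ?\<mu> x (minv J (i b * s))" if "x \<in> I" for x b s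
    unfolding mJ(4) by (rule bal[OF that mJ(1)])
  have rs: "?\<mu> x (minv J (s * t)) = ract (oS (sub_BB i ?K)) (?\<mu> x (minv J s)) t" if "x \<in> I" for x s t
    unfolding mJ(3) by (rule \<mu>h(4)[OF that mJ(1)])
  have G: "right_hom (oS (sub_BB i I)) (oS (sub_BB i ?K)) G"
    and G_tS: "\<And>x s. x \<in> I \<Longrightarrow> G (tS (sub_BB i I) x s) = ?\<mu> x (minv J s)"
    by (rule tl; simp add: \<mu>h add b rs mJ(1,2))+
  show ?thesis
  proof (rule IrI[OF K, of "\<lambda>s. G (minv I s)"])
    show "G (minv I s) \<in> carr (oS (sub_BB i ?K))" for s
      using right_homD(2)[OF G minv_carr[OF I]] .
    have \<mu>_mr: "mr i ?K (?\<mu> x B) = x * mr i J B" if "x \<in> I" "B \<in> carr (oS (sub_BB i J))" for x B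
      using right_mod_sub[OF J'] that(2)
    proof (induction rule: oS_induct)
      case (tens z s)
      then show ?case using that(1) by (simp add: \<mu>(2) mr_tS[OF K] mr_tS[OF J'] subprod_mult mult.assoc)
    next
      case (add A B)
      then show ?case using that(1) right_homD(3)[OF mr_hom[OF K]] right_homD(3)[OF mr_hom[OF J']]
        by (simp add: \<mu>h distrib_left)
    qed
    have "mr i ?K (G A) = mr i I A" if "A \<in> carr (oS (sub_BB i I))" for A
      using right_mod_sub[OF I'] that
    proof (induction rule: oS_induct)
      case (tens x s)
      then show ?case by (simp add: G_tS \<mu>_mr mJ(1) mr_minv[OF J] mr_tS[OF I'])
    next
      case (add A B)
      then show ?case using right_homD(3)[OF mr_hom[OF K]] right_homD(3)[OF mr_hom[OF I']]
        by (simp add: right_homD[OF G])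
    qed
    from this[OF minv_carr[OF I]] show "mr i ?K (G (minv I s)) = s" for s
      by (simp add: mr_minv[OF I])
    show "G (minv I (mr i ?K A)) = A" if "A \<in> carr (oS (sub_BB i ?K))" for A
      using right_mod_sub[OF K] that
    proof (induction rule: oS_induct)
      case (tens z s)
      then have z: "z \<in> subprod I J" by simp
      from z subbimodsD(1)[OF I'] subbimodsD(1)[OF J']
      \<comment> \<open>Membership in \<open>?K\<close> is carried through the induction because the
        sum case of \<open>subprod_induct\<close> does not supply it.\<close>
      have "z \<in> ?K \<and> G (minv I (z * s)) = tS (sub_BB i ?K) z s"
      proof (induction rule: subprod_induct)
        case (mult x y)
        have "minv I (x * y * s) = tS (sub_BB i I) x (y * s)"
          using minv_simps(4)[OF I] mult by (simp add: mult.assoc)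
        then show ?case using mult mJ(5) \<mu>(2) by (simp add: G_tS subprod_mult)
      next
        case (add x y)
        then show ?case using right_homD(3)[OF G minv_carr[OF I] minv_carr[OF I]] c(2)[of x y s]
          by (simp add: distrib_right minv_simps(1)[OF I] subprod_add)
      qed
      then show ?case by (simp add: mr_tS[OF K])
    next
      case (add A B)
      then show ?case using right_homD(3)[OF mr_hom[OF K]] right_homD(3)[OF G minv_carr[OF I] minv_carr[OF I]]
        by (simp add: minv_simps(1)[OF I])
    qed
  qed
qed

text \<open>The order is reversed because \<open>Gamma' i I\<close> sends
  \<open>1 \<otimes> x * y\<close> to \<open>x \<otimes> y\<close> by right linearity, and
  \<open>Gamma' i J\<close> sends this to \<open>x * y \<otimes> 1\<close> by left linearity: the
  left factor of the product acts first.\<close>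

lemma Gamma'_subprod:
  assumes I: "I \<in> Ir i" and J: "J \<in> Ir i"
  shows "Gamma' i (subprod I J) = compose (carr T) (Gamma' i J) (Gamma' i I)"
proof (rule Gamma'_eqI[OF subprod_Ir[OF I J]])
  note gI = Gamma'_left[OF I] Gamma'_right[OF I] and gJ = Gamma'_left[OF J] Gamma'_right[OF J]
  note T = left_modD[OF left_mod_T] right_modD[OF right_mod_T] abelian_grpD(2)[OF left_modD(1)[OF left_mod_T]]
  let ?g = "compose (carr T) (Gamma' i J) (Gamma' i I)"
  show "left_hom T T ?g" and r: "right_hom T T ?g"
    using left_hom_comp[OF gI(1) gJ(1)] right_hom_comp[OF gI(2) gJ(2)] T
    by (simp_all add: left_hom_def right_hom_def ab_hom_def compose_def Pi_iff)
  show "?g (tT 1 z) = tT z 1" if "z \<in> subprod I J" for z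
    using that subbimodsD(1)[OF Ir_subbimods[OF I]] subbimodsD(1)[OF Ir_subbimods[OF J]]
  proof (induction rule: subprod_induct)
    case (mult x y)
    have "Gamma' i I (tT 1 (x * y)) = tT x y"
      using right_homD(4)[OF gI(2), of "tT 1 x" y] Gamma'_unit[OF I mult(1)] by (simp add: T_simps)
    moreover have "Gamma' i J (tT x y) = tT (x * y) 1"
      using left_homD(4)[OF gJ(1), of "tT 1 y" x] Gamma'_unit[OF J mult(2)] by (simp add: T_simps)
    ultimately show ?case by (simp add: compose_def T_simps(1))
  next
    case (add x y)
    then show ?case using right_homD(3)[OF r, of "tT 1 x" "tT 1 y"] by (simp add: T_simps)
  qed
qed (simp add: compose_extensional)

end

section \<open>Injectivity and surjectivity of \<open>\<Gamma>'\<close>\<close>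

lemma right_hom_inv:
  assumes M: "right_mod M" and f: "right_hom M N f" and bij: "bij_betw f (carr M) (carr N)"
  shows "right_hom N M (the_inv_into (carr M) f)"
proof -
  have inj: "inj_on f (carr M)" and im: "f ` carr M = carr N" using bij by (auto simp: bij_betw_def)
  note fi = the_inv_into_f_f[OF inj] and h = right_homD(3,4)[OF f, symmetric]
  have "the_inv_into (carr M) f y \<in> carr M" if "y \<in> carr N" for y
    using the_inv_into_into[OF inj _ subset_refl] that im by simp
  moreover have "the_inv_into (carr M) f (addg N y y') =
      addg M (the_inv_into (carr M) f y) (the_inv_into (carr M) f y')"
    if y: "y \<in> carr N" "y' \<in> carr N" for y y'
  proof -
    obtain x x' where "y = f x" "x \<in> carr M" "y' = f x'" "x' \<in> carr M" using y im by (metis imageE)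
    then show ?thesis using fi h(1)[of x x'] abelian_grpD(2)[OF right_modD(1)[OF M]] by simp
  qed
  moreover have "the_inv_into (carr M) f (ract N y r) = ract M (the_inv_into (carr M) f y) r"
    if y: "y \<in> carr N" for y r
  proof -
    obtain x where "y = f x" "x \<in> carr M" using y im by (metis imageE)
    then show ?thesis using fi h(2)[of x r] right_modD(2)[OF M] by simp
  qed
  ultimately show ?thesis by (simp add: right_hom_def ab_hom_def)
qed

lemma right_hom_restrict:
  assumes "right_mod M" "right_hom M N f"
  shows "right_hom M N (restrict f (carr M))"
  using assms right_modD(2)[OF assms(1)] abelian_grpD(2)[OF right_modD(1)[OF assms(1)]]
  by (simp add: right_hom_def ab_hom_def Pi_iff)

section \<open>Injectivity: recovering \<open>I\<close> from \<open>Gamma' i I\<close>\<close>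

context comonadic_ext
begin

definition eS :: "'b \<Rightarrow> ('a, 'b) univ" where "eS s = {[(0, s)]}"

lemma inj_eS: "inj_on eS A"
  by (auto simp: inj_on_def eS_def)

text \<open>Along the isomorphism \<open>I \<otimes> S \<cong> S\<close> the canonical coaction on \<open>I \<otimes> S\<close> becomes \<open>s \<mapsto> \<Gamma>'(I)(1 \<otimes> s)\<close>,
  and the coinvariants of \<open>I \<otimes> S\<close> are \<open>I\<close>.\<close>
lemma Ir_coinvariant:
  assumes I: "I \<in> Ir i" and x: "Gamma' i I (tT 1 x) = tT x 1"
  shows "x \<in> I"
proof -
  note J = Ir_subbimods[OF I]
  let ?J = "sub_BB i I"
  note rJ = right_mod_sub[OF J]
  interpret E: module_copy eS ?J
    by unfold_locales (simp_all add: inj_eS rJ)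
  let ?X = "copy eS ?J"
  note X = E.right_mod_copy and e = E.e_hom
  let ?e = "mapS ?J ?X eS"
  note me = mapS[OF rJ X e] and RX = right_mod_restr_oS[OF X]
  note meh = right_homD[OF me(1)]
  \<comment> \<open>The isomorphism of \<open>S\<close> with \<open>I \<otimes> S\<close>, followed
    by the passage to the copy of \<open>I\<close> in \<open>univ\<close>.\<close>
  define \<phi> where "\<phi> s = ?e (minv I s)" for s
  have "right_hom S_SS (oS ?X) \<phi>"
    unfolding right_hom_def ab_hom_def \<phi>_def
    using meh minv_carr[OF I] minv_simps(1,2)[OF I] by simp
  then have \<phi>: "right_hom (S_SB i) (restr i (oS ?X)) \<phi>"
    by (simp add: right_hom_def ab_hom_def)
  note m\<phi> = mapS[OF right_mod_S_SB RX \<phi>]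
  let ?A = "?e (minv I x)"
  have A: "?A \<in> carr (oS ?X)" by (rule meh(2)[OF minv_carr[OF I]])
  define N where "N = \<nu> I 1"
  have N: "right_hom (oS ?J) (oS (S_SB i)) N" and N_tS: "\<And>y s. y \<in> I \<Longrightarrow> N (tS ?J y s) = tT y s"
    unfolding N_def using \<nu>_hom[OF J, of 1] \<nu>_tS[OF J, of _ 1] by (simp_all only: sweedler_eq mult_1)
  \<comment> \<open>The canonical coaction factors through \<open>S \<otimes> S\<close>:
    \<open>\<phi> y\<close> is \<open>y \<otimes> 1\<close> for \<open>y\<close> in
    \<open>I\<close>. At \<open>minv I x\<close> the first factor \<open>N\<close> yields
    \<open>Gamma' i I (1 \<otimes> x)\<close>, which is \<open>x \<otimes> 1\<close> by hypothesis,
    and the second turns this into \<open>\<phi> x \<otimes> 1\<close>, so \<open>\<phi> x\<close>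
    is coinvariant.\<close>
  have "mapS (S_SB i) (restr i (oS ?X)) \<phi> (N Z) = Kcoact i ?X (?e Z)" if "Z \<in> carr (oS ?J)" for Z
    using rJ that
  proof (induction rule: oS_induct)
    case (tens y s)
    then have y: "y \<in> I" by simp
    have "\<phi> y = tS ?X (eS y) 1"
      using minv_simps(4)[OF I y, of 1] me(2)[of y 1] y by (simp add: \<phi>_def)
    then show ?case
      using y m\<phi>(2)[of y s] N_tS[OF y, of s] me(2)[of y s] Kcoact_tS[OF X, of "eS y" s]
      by (simp add: E.copy_simps)
  next
    case (add Z Z')
    then show ?case
      using right_homD(2,3)[OF N] right_homD(3)[OF m\<phi>(1)] right_homD(3)[OF Kcoact_hom[OF X]] meh(2,3) by simp
  qed
  from this[OF minv_carr[OF I, of x]] have "Kcoact i ?X ?A = mapS (S_SB i) (restr i (oS ?X)) \<phi> (tT x 1)"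
    using x unfolding N_def Gamma'_tT[OF I] by simp
  also have "\<dots> = tS (restr i (oS ?X)) ?A 1"
    using m\<phi>(2)[of x 1] by (simp add: \<phi>_def)
  finally obtain z where z: "z \<in> carr ?X" "?A = tS ?X z 1"
    using coinvariant_unit[OF X A] by blast
  then obtain y where y: "y \<in> I" "z = eS y" by (auto simp: E.copy_simps)
  note md = mapS[OF X rJ E.d_hom]
  have "minv I x = mapS ?X ?J E.d ?A"
  proof -
    have "mapS ?X ?J E.d ?A = mapS ?J ?J id (minv I x)"
      by (rule mapS_comp[OF rJ X rJ e E.d_hom])
        (simp_all add: E.d_e minv_carr[OF I] right_hom_def ab_hom_def)
    also have "\<dots> = minv I x" by (rule mapS_id[OF rJ minv_carr[OF I]]) simp
    finally show ?thesis by simp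
  qed
  also have "\<dots> = tS ?J y 1" using z y md(2)[of z 1] by (simp add: E.d_e)
  finally have "mr i I (minv I x) = y" using mr_tS[OF J y(1)] by simp
  then show ?thesis using y by (simp add: mr_minv[OF I])
qed

end

lemma End_corD:
  assumes "g \<in> End_cor i"
  shows "g \<in> extensional (carr (sweedler i))"
    and "left_hom (sweedler i) (sweedler i) g" "right_hom (sweedler i) (sweedler i) g"
    and "A \<in> carr (sweedler i) \<Longrightarrow>
      comult i (g A) = tmap (sweedler i) (sweedler i) (sweedler i) (sweedler i) g g (comult i A)"
    and "A \<in> carr (sweedler i) \<Longrightarrow> counit i (g A) = counit i A"
  using assms unfolding End_cor_def by blast+

section \<open>Surjectivity: the comodule attached to a coring endomorphism\<close>

context ring_ext
begin

lemma restr_S_SS: "restr i S_SS = S_SB i"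
  by (simp add: restr_def S_SS_def S_SB_def)

lemma End_cor_right:
  assumes g: "g \<in> End_cor i"
  shows "g (tT 1 s) \<in> carr T" "ract T (g (tT 1 s)) t = g (tT 1 (s * t))"
    "right_hom S_SS T (\<lambda>s. g (tT 1 s))"
proof -
  note r = right_homD[OF End_corD(3)[OF g]]
  show 1: "g (tT 1 s) \<in> carr T" for s by (simp add: r(2) T_simps(1))
  show 2: "ract T (g (tT 1 s)) t = g (tT 1 (s * t))" for s t
    using r(4)[of "tT 1 s" t] by (simp add: T_simps)
  show "right_hom S_SS T (\<lambda>s. g (tT 1 s))"
    by (simp add: right_hom_def ab_hom_def 1 2) (simp add: T_simps r(3))
qed

text \<open>Coassociativity of the coaction \<open>s \<mapsto> g(1 \<otimes> s)\<close> on \<open>S\<close>, obtained by pushing the compatibility of \<open>g\<close>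
  with the comultiplication along \<open>(S \<otimes>\<^sub>B S) \<otimes>\<^sub>S (S \<otimes>\<^sub>B S) \<rightarrow> (S \<otimes>\<^sub>B S) \<otimes>\<^sub>B S\<close>.\<close>
lemma End_cor_coassoc:
  assumes g: "g \<in> End_cor i"
  shows "mapS (S_SB i) (restr i T) (\<lambda>s. g (tT 1 s)) (g (tT 1 s)) = Kcoact i (S_SB i) (g (tT 1 s))"
proof -
  note R = right_mod_restr[OF right_mod_T]
  let ?P = "oS (restr i T)"
  note aP = ab_oS[OF R] and aT = abelian_grpD(2)[OF right_modD(1)[OF right_mod_T]]
  have rh: "right_hom (S_SB i) (restr i T) (ract T A)" if "A \<in> carr T" for A
    using that right_modD(2,4,5)[OF right_mod_T] by (simp add: right_hom_def ab_hom_def)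
  \<comment> \<open>The canonical map over \<open>S\<close> that sends
    \<open>A \<otimes> (a \<otimes> t)\<close> to \<open>A a \<otimes> t\<close>, with
    \<open>A\<close> frozen.\<close>
  let ?L = "\<lambda>A. mapS (S_SB i) (restr i T) (ract T A)"
  have L: "right_hom T ?P (?L A)" "\<And>a t. ?L A (tT a t) = tS (restr i T) (ract T A a) t" if "A \<in> carr T" for A
    using mapS[OF right_mod_S_SB R rh[OF that]] by (simp_all add: sweedler_eq)
  note Lh = right_homD(2,3)[OF L(1)]
  have bal: "balanced_map T T ?P ?L"
    unfolding balanced_map_def
  proof (intro conjI ballI allI)
    fix A B assume A: "A \<in> carr T" and B: "B \<in> carr T"
    show "?L A B \<in> carr ?P" by (rule Lh(1)[OF A B])
    show "?L A (addg T B B') = addg ?P (?L A B) (?L A B')" if "B' \<in> carr T" for B'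
      by (rule Lh(2)[OF A B that])
    show "?L (ract T A r) B = ?L A (lact T r B)" for r
      using B
    proof (induction rule: T_induct)
      case (tens s t)
      show ?case using A right_modD(2,5)[OF right_mod_T A] by (simp add: L T_simps)
    next
      case (add B B')
      then show ?case using A right_modD(2)[OF right_mod_T] left_modD(2,3)[OF left_mod_T] by (simp add: Lh)
    qed
  next
    fix A A' B assume A: "A \<in> carr T" "A' \<in> carr T" and B: "B \<in> carr T"
    show "?L (addg T A A') B = addg ?P (?L A B) (?L A' B)"
      using B
    proof (induction rule: T_induct)
      case (tens s t)
      show ?case
        unfolding L(2)[OF A(1)] L(2)[OF A(2)] L(2)[OF aT[OF A]]
        using A right_modD(2,3)[OF right_mod_T] oS_simps(2)[OF R] by simp
    next
      case (add B B')
      then show ?case using A by (simp add: Lh aT addg_swap[OF aP])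
    qed
  qed
  let ?\<Psi> = "tlift T T ?P ?L"
  note \<Psi> = TT.tlift[OF aP bal]
  \<comment> \<open>Along this map the comultiplication becomes the canonical coaction, since
    \<open>(s \<otimes> 1) \<otimes> (1 \<otimes> t)\<close> goes to
    \<open>(s \<otimes> 1) \<otimes> t\<close>.\<close>
  have "?\<Psi> (comult i A) = Kcoact i (S_SB i) A" if "A \<in> carr T" for A
    using that
  proof (induction rule: T_induct)
    case (tens s t)
    show ?case
      using Kcoact_tS[OF right_mod_S_SB, of s t]
      by (simp add: comult_tT \<Psi>(3) T_simps L sweedler_eq)
  next
    case (add A B)
    then show ?case
      using right_homD(2,3)[OF comult_right] ab_homD(2)[OF \<Psi>(2)]
        right_homD(3)[OF Kcoact_hom[OF right_mod_S_SB]] by (simp add: sweedler_eq)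
  qed
  from this[OF End_cor_right(1)[OF g]] have "Kcoact i (S_SB i) (g (tT 1 s)) = ?\<Psi> (comult i (g (tT 1 s)))"
    by simp
  also have "\<dots> = ?\<Psi> (tens T T (g (tT 1 1)) (g (tT 1 s)))"
    by (simp add: End_corD(4)[OF g] T_simps(1) comult_tT tmap_TT(3)[OF End_corD(2,3)[OF g]])
  also have "\<dots> = ?L (g (tT 1 1)) (g (tT 1 s))"
    by (simp add: \<Psi>(3) End_cor_right(1)[OF g])
  \<comment> \<open>By right linearity, acting on \<open>g (1 \<otimes> 1)\<close> is the whole
    coaction; so the left tensor factor turns into the iterated coaction.\<close>
  also have "ract T (g (tT 1 1)) = (\<lambda>s. g (tT 1 s))"
    by (rule ext) (simp add: End_cor_right(2)[OF g])
  finally show ?thesis by simp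
qed

lemma End_cor_subbimod:
  assumes g: "g \<in> End_cor i"
  shows "{s. g (tT 1 s) = tT s 1} \<in> subbimods i"
proof -
  note l = left_homD[OF End_corD(2)[OF g]] and r = right_homD[OF End_corD(3)[OF g]]
  let ?I = "{s. g (tT 1 s) = tT s 1}"
  have aT: "abelian_grp T" using right_mod_T by (rule right_modD(1))
  have z: "tT 1 0 = zerog T" by (rule addg_self_zero[OF aT]) (simp_all add: T_simps flip: T_simps(4))
  have "g (tT 1 0) = zerog T"
    by (rule addg_self_zero[OF aT]) (simp_all add: T_simps l(2) flip: T_simps(4) l(3))
  moreover have "tT 0 1 = tT 1 0" using T_simps(2)[of 1 0 1] by simp
  ultimately have "0 \<in> ?I" using z by simp
  moreover have "x + y \<in> ?I" if "x \<in> ?I" "y \<in> ?I" for x y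
    using that l(3)[of "tT 1 x" "tT 1 y"] by (simp add: T_simps)
  moreover have R: "x * i b \<in> ?I" if "x \<in> ?I" for x b
    using that r(4)[of "tT 1 x" "i b"] T_simps(2)[of x b 1] by (simp add: T_simps(1,6))
  moreover have "i b * x \<in> ?I" if "x \<in> ?I" for x b
    using that l(4)[of "tT 1 x" "i b"] T_simps(2)[of 1 b x] by (simp add: T_simps(1,5))
  moreover have "- x \<in> ?I" if "x \<in> ?I" for x
    using R[OF that, of "- 1"] by (simp add: i_minus)
  ultimately show ?thesis by (simp add: subbimods_def)
qed

end

context comonadic_ext
begin

text \<open>Essential surjectivity gives \<open>X\<close> with \<open>X \<otimes> S\<close>
  isomorphic to \<open>S\<close> as comodules. The induced map from \<open>X\<close> onto the
  coinvariants \<open>I\<close> stays onto after tensoring with \<open>S\<close>, and followed by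
  \<open>mr\<close> it is the given isomorphism. A bijection that factors through a surjection
  forces the second factor to be bijective, so the question whether \<open>X\<close> maps
  injectively to \<open>I\<close> does not arise.\<close>

lemma End_cor_Ir:
  assumes g: "g \<in> End_cor i"
  shows "{s. g (tT 1 s) = tT s 1} \<in> Ir i"
proof -
  let ?I = "{s. g (tT 1 s) = tT s 1}"
  note I = End_cor_subbimod[OF g]
  interpret E: module_copy eS "S_SS :: ('b,'b,'b) bimod"
    by unfold_locales (simp_all add: inj_eS right_mod_S_SS)
  let ?Y = "copy eS (S_SS :: ('b,'b,'b) bimod)"
  note Y = E.right_mod_copy
  note RY = right_mod_restr[OF Y] and RT = right_mod_restr[OF right_mod_T]
  have e: "right_hom (S_SB i) (restr i ?Y) eS" and d: "right_hom (restr i ?Y) (S_SB i) E.d"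
    using right_hom_restr[OF E.e_hom] right_hom_restr[OF E.d_hom] by (simp_all add: restr_S_SS)
  have Yc: "carr ?Y = range eS" and d_e: "\<And>s. E.d (eS s) = s" and e_d: "\<And>y. y \<in> carr ?Y \<Longrightarrow> eS (E.d y) = y"
    using E.copy_simps(1) E.d_e by auto
  let ?W = "oS (restr i ?Y)"
  let ?M = "mapS (S_SB i) (restr i ?Y) eS"
  have M: "right_hom T ?W ?M" and M_tT: "\<And>s t. ?M (tT s t) = tS (restr i ?Y) (eS s) t"
    using mapS[OF right_mod_S_SB RY e] by (simp_all add: sweedler_eq)
  note RW = right_mod_restr_oS[OF RY]
  have M_inj: "A = B" if "A \<in> carr T" "B \<in> carr T" "?M A = ?M B" for A B
  proof -
    have "mapS (restr i ?Y) (S_SB i) E.d (?M Z) = Z" if "Z \<in> carr T" for Z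
    proof -
      have "mapS (restr i ?Y) (S_SB i) E.d (?M Z) = mapS (S_SB i) (S_SB i) id Z"
        by (rule mapS_comp[OF right_mod_S_SB RY right_mod_S_SB e d])
          (use that in \<open>simp_all add: d_e sweedler_eq right_hom_def ab_hom_def\<close>)
      also have "\<dots> = Z" by (rule mapS_id[OF right_mod_S_SB]) (use that in \<open>simp_all add: sweedler_eq\<close>)
      finally show ?thesis .
    qed
    then show ?thesis using that by metis
  qed
  \<comment> \<open>The coaction sending \<open>s\<close> to \<open>g (1 \<otimes> s)\<close>, read
    on the copy of \<open>S\<close> in \<open>univ\<close>; comodule structures are extensional by
    definition.\<close>
  define \<theta> where "\<theta> = restrict (\<lambda>y. ?M (g (tT 1 (E.d y)))) (carr ?Y)"
  have \<theta>_e: "\<theta> (eS s) = ?M (g (tT 1 s))" for s by (simp add: \<theta>_def Yc d_e)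
  have \<theta>: "right_hom ?Y ?W \<theta>"
    unfolding \<theta>_def
    by (rule right_hom_restrict[OF Y right_hom_comp[OF right_hom_comp[OF E.d_hom End_cor_right(3)[OF g]] M]])
  have \<theta>_restr: "right_hom (restr i ?Y) (restr i ?W) \<theta>" by (rule right_hom_restr[OF \<theta>])
  have com: "is_comodule i ?Y \<theta>"
    unfolding is_comodule_def mapS_def[symmetric]
  proof (intro conjI ballI)
    show "right_mod ?Y" by (rule Y)
    show "\<theta> \<in> extensional (carr ?Y)" by (simp add: \<theta>_def)
    show "right_hom ?Y ?W \<theta>" by (rule \<theta>)
    fix y assume "y \<in> carr ?Y"
    then obtain s where y: "y = eS s" using Yc by auto
    let ?act = "tlift (restr i ?Y) (S_BS i) ?Y (\<lambda>z s. ract ?Y z s)"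
    have act: "right_hom ?W ?Y ?act" "\<And>x s. x \<in> carr ?Y \<Longrightarrow> ?act (tS (restr i ?Y) x s) = ract ?Y x s"
      using tlift_oS(2,3)[OF RY Y, of "\<lambda>z s. ract ?Y z s"] right_modD(2-5)[OF Y] by simp_all
    \<comment> \<open>Multiplication on the copy corresponds to the counit of the coring, so the
      counit axiom for \<open>\<theta>\<close> reduces to the compatibility of \<open>g\<close> with
      \<open>counit\<close>.\<close>
    have "?act (?M A) = eS (counit i A)" if "A \<in> carr T" for A
      using that
    proof (induction rule: T_induct)
      case (tens s t)
      show ?case using act(2)[of "eS s" t] E.copy_simps(4)[of s t] by (simp add: M_tT counit_tT Yc)
    next
      case (add A B)
      then show ?case
        using right_homD(2,3)[OF M] right_homD(3)[OF act(1)] right_homD(3)[OF counit_right] E.copy_simps(2)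
        by simp
    qed
    from this[OF End_cor_right(1)[OF g, of s]] show "?act (\<theta> y) = y"
      by (simp add: y \<theta>_e End_corD(5)[OF g] T_simps(1) counit_tT)
    let ?c = "g (tT 1 s)"
    have c: "?c \<in> carr (oS (S_SB i))" using End_cor_right(1)[OF g] by (simp add: sweedler_eq)
    let ?\<theta>c = "\<lambda>s. g (tT 1 s)"
    have \<theta>c: "right_hom (S_SB i) (restr i T) ?\<theta>c"
      using right_hom_restr[OF End_cor_right(3)[OF g]] by (simp add: restr_S_SS)
    have \<eta>c: "right_hom (S_SB i) (restr i T) (eta' i (S_SB i))"
      using eta_hom[OF right_mod_S_SB] by (simp add: sweedler_eq)
    have rM: "right_hom (restr i T) (restr i ?W) ?M" by (rule right_hom_restr[OF M])
    \<comment> \<open>Functoriality moves both sides of the coassociativity axiom from the copy back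
      to \<open>S\<close>, where it is \<open>End_cor_coassoc\<close>.\<close>
    have "mapS (restr i ?Y) (restr i ?W) \<theta> (\<theta> y) = mapS (S_SB i) (restr i ?W) (\<lambda>s. ?M (?\<theta>c s)) ?c"
      unfolding y \<theta>_e
      by (rule mapS_comp[OF right_mod_S_SB RY RW e \<theta>_restr right_hom_comp[OF \<theta>c rM] _ c]) (simp add: \<theta>_e)
    also have "\<dots> = mapS (restr i T) (restr i ?W) ?M (mapS (S_SB i) (restr i T) ?\<theta>c ?c)"
      by (rule mapS_comp[OF right_mod_S_SB RT RW \<theta>c rM right_hom_comp[OF \<theta>c rM] _ c, symmetric]) simp
    also have "mapS (S_SB i) (restr i T) ?\<theta>c ?c = mapS (S_SB i) (restr i T) (eta' i (S_SB i)) ?c"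
      using End_cor_coassoc[OF g, of s] by (simp add: Kcoact_def Kobj_def sweedler_eq flip: mapS_def)
    also have "mapS (restr i T) (restr i ?W) ?M (mapS (S_SB i) (restr i T) (eta' i (S_SB i)) ?c) =
        mapS (S_SB i) (restr i ?W) (\<lambda>s. ?M (eta' i (S_SB i) s)) ?c"
      by (rule mapS_comp[OF right_mod_S_SB RT RW \<eta>c rM right_hom_comp[OF \<eta>c rM] _ c]) simp
    also have "\<dots> = mapS (restr i ?Y) (restr i ?W) (eta' i (restr i ?Y)) (\<theta> y)"
      unfolding y \<theta>_e
      by (rule mapS_comp[OF right_mod_S_SB RY RW e eta_hom[OF RY] right_hom_comp[OF \<eta>c rM] _ c, symmetric])
        (simp add: eta'_def M_tT)
    finally show "mapS (restr i ?Y) (restr i ?W) \<theta> (\<theta> y) =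
        mapS (restr i ?Y) (restr i ?W) (eta' i (restr i ?Y)) (\<theta> y)" .
  qed
  obtain X :: "(('a, 'b) univ, unit, 'a) bimod" and f where X: "right_mod X"
    and cf: "comod_hom i (Kobj i X) (Kcoact i X) ?Y \<theta> f" and bij: "bij_betw f (carr (Kobj i X)) (carr ?Y)"
    using comon com unfolding comonadic_def by blast
  have f: "right_hom (oS X) ?Y f" and bij: "bij_betw f (carr (oS X)) (carr ?Y)"
    using cf bij by (simp_all add: comod_hom_def Kobj_def)
  have f_co: "\<theta> (f A) = mapS (restr i (oS X)) (restr i ?Y) f (Kcoact i X A)" if "A \<in> carr (oS X)" for A
    using cf that by (simp add: comod_hom_def Kobj_def mapS_def)
  let ?P = "restr i (oS X)"
  note RP = right_mod_restr_oS[OF X] and fh = right_homD[OF f] and xs = oS_simps[OF X]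
  have fr: "right_hom ?P (restr i ?Y) f" by (rule right_hom_restr[OF f])
  define h where "h = the_inv_into (carr (oS X)) f"
  have hf: "h (f A) = A" if "A \<in> carr (oS X)" for A
    unfolding h_def by (rule the_inv_into_f_f[OF bij_betw_imp_inj_on[OF bij] that])
  have h: "right_hom ?Y (oS X) h"
    unfolding h_def by (rule right_hom_inv[OF right_mod_oS[OF X] f bij])
  have fh_id: "f (h y) = y" if "y \<in> carr ?Y" for y
    unfolding h_def by (rule f_the_inv_into_f_bij_betw[OF bij]) (use that in simp)
  have mf_inj: "A = B" if "A \<in> carr (oS ?P)" "B \<in> carr (oS ?P)"
    "mapS ?P (restr i ?Y) f A = mapS ?P (restr i ?Y) f B" for A B
  proof -
    have "mapS (restr i ?Y) ?P h (mapS ?P (restr i ?Y) f Z) = Z" if "Z \<in> carr (oS ?P)" for Z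
    proof -
      have "mapS (restr i ?Y) ?P h (mapS ?P (restr i ?Y) f Z) = mapS ?P ?P id Z"
        by (rule mapS_comp[OF RP RY RP fr right_hom_restr[OF h] _ _ that])
          (simp_all add: hf right_hom_def ab_hom_def)
      also have "\<dots> = Z" by (rule mapS_id[OF RP that]) simp
      finally show ?thesis .
    qed
    then show ?thesis using that by metis
  qed
  note mf = mapS[OF RP RY fr]
  \<comment> \<open>The unit element \<open>x \<otimes> 1\<close> carried over to \<open>S\<close>
    by the comodule isomorphism \<open>f\<close>. It is coinvariant because
    \<open>x \<otimes> 1\<close> is.\<close>
  define \<alpha> where "\<alpha> x = E.d (f (tS X x 1))" for x
  have e\<alpha>: "eS (\<alpha> x) = f (tS X x 1)" if "x \<in> carr X" for x
    unfolding \<alpha>_def by (rule e_d) (use that xs fh in simp)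
  have \<alpha>I: "\<alpha> x \<in> ?I" if x: "x \<in> carr X" for x
  proof -
    have "?M (g (tT 1 (\<alpha> x))) = \<theta> (f (tS X x 1))" using \<theta>_e e\<alpha>[OF x] by metis
    also have "\<dots> = tS (restr i ?Y) (f (tS X x 1)) 1"
      using f_co[of "tS X x 1"] xs(1)[OF x] Kcoact_tS[OF X x] mf(2)[of "tS X x 1" 1] by simp
    also have "\<dots> = ?M (tT (\<alpha> x) 1)" using e\<alpha>[OF x] by (simp add: M_tT)
    finally show ?thesis using M_inj End_cor_right(1)[OF g] T_simps(1) by simp
  qed
  \<comment> \<open>Conversely, a coinvariant \<open>s\<close> pulls back along \<open>f\<close> to
    a coinvariant of \<open>X \<otimes> S\<close>; \<open>mf_inj\<close> transfers the equation, and
    comonadicity makes the element a unit \<open>x \<otimes> 1\<close>.\<close>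
  have \<alpha>_surj: "\<exists>x\<in>carr X. \<alpha> x = s" if s: "s \<in> ?I" for s
  proof -
    let ?A = "h (eS s)"
    have es: "eS s \<in> carr ?Y" by (simp add: Yc)
    have A: "?A \<in> carr (oS X)" by (rule right_homD(2)[OF h es])
    have "mapS ?P (restr i ?Y) f (Kcoact i X ?A) = ?M (tT s 1)"
      using f_co[OF A] fh_id[OF es] \<theta>_e s by simp
    also have "\<dots> = mapS ?P (restr i ?Y) f (tS ?P ?A 1)"
      using mf(2)[of ?A 1] A fh_id[OF es] by (simp add: M_tT)
    finally have "Kcoact i X ?A = tS ?P ?A 1"
      using mf_inj right_homD(2)[OF Kcoact_hom[OF X] A] oS_simps(1)[OF RP, of ?A 1] A by simp
    then obtain x where x: "x \<in> carr X" "?A = tS X x 1" using coinvariant_unit[OF X A] by blast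
    then have "f (tS X x 1) = eS s" using fh_id[OF es] by simp
    then show ?thesis using x d_e[of s] by (intro bexI[of _ x]) (simp_all add: \<alpha>_def)
  qed
  have "right_hom X (S_SB i) \<alpha>"
    unfolding \<alpha>_def using right_hom_comp[OF right_hom_comp[OF eta_hom[OF X] fr] d]
    by (simp add: eta'_def)
  then have \<alpha>: "right_hom X (sub_BB i ?I) \<alpha>"
    using \<alpha>I by (simp add: right_hom_def ab_hom_def)
  let ?\<alpha> = "mapS X (sub_BB i ?I) \<alpha>"
  note m\<alpha> = mapS[OF X right_mod_sub[OF I] \<alpha>]
  note m\<alpha>h = right_homD[OF m\<alpha>(1)]
  \<comment> \<open>By right linearity of \<open>f\<close>, multiplying \<open>\<alpha> x\<close> by
    \<open>s\<close> gives \<open>f (x \<otimes> s)\<close> read in \<open>S\<close>: this is the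
    factorisation of the bijection \<open>f\<close> through \<open>mr\<close>.\<close>
  have mr_\<alpha>: "mr i ?I (?\<alpha> A) = E.d (f A)" if "A \<in> carr (oS X)" for A
    using X that
  proof (induction rule: oS_induct)
    case (tens x s)
    have "f (tS X x s) = ract ?Y (f (tS X x 1)) s"
      using fh(4)[OF xs(1)[OF tens, of 1], of s] xs(5)[OF tens, of 1 s] by simp
    then have "E.d (f (tS X x s)) = \<alpha> x * s"
      using right_homD(4)[OF E.d_hom fh(2)[OF xs(1)[OF tens, of 1]], of s] by (simp add: \<alpha>_def)
    then show ?case using tens m\<alpha>(2)[OF tens, of s] mr_tS[OF I \<alpha>I[OF tens], of s] by simp
  next
    case (add A B)
    then show ?case
      using fh(2,3) m\<alpha>h(2,3) right_homD(3)[OF mr_hom[OF I]] right_homD(3)[OF E.d_hom] by simp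
  qed
  have im: "Z \<in> ?\<alpha> ` carr (oS X)" if "Z \<in> carr (oS (sub_BB i ?I))" for Z
    using right_mod_sub[OF I] that
  proof (induction rule: oS_induct)
    case (tens s t)
    then obtain x where "x \<in> carr X" "\<alpha> x = s" using \<alpha>_surj[of s] by auto
    then show ?case using m\<alpha>(2)[of x t] xs(1)[of x t] by (intro image_eqI[of _ _ "tS X x t"]) simp_all
  next
    case (add A B)
    then obtain A' B' where "A' \<in> carr (oS X)" "B' \<in> carr (oS X)" "A = ?\<alpha> A'" "B = ?\<alpha> B'" by blast
    then show ?case
      using m\<alpha>h(3)[of A' B'] xs(7)[of A' B'] by (intro image_eqI[of _ _ "addg (oS X) A' B'"]) simp_all
  qed
  show ?thesis
  proof (rule IrI[OF I, of "\<lambda>s. ?\<alpha> (h (eS s))"])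
    have h_e: "h (eS s) \<in> carr (oS X)" for s using right_homD(2)[OF h] by (simp add: Yc)
    show "?\<alpha> (h (eS s)) \<in> carr (oS (sub_BB i ?I))" for s by (rule m\<alpha>h(2)[OF h_e])
    show "mr i ?I (?\<alpha> (h (eS s))) = s" for s
      using mr_\<alpha>[OF h_e[of s]] fh_id[of "eS s"] by (simp add: Yc d_e)
    show "?\<alpha> (h (eS (mr i ?I Z))) = Z" if Z: "Z \<in> carr (oS (sub_BB i ?I))" for Z
    proof -
      obtain A where A: "Z = ?\<alpha> A" "A \<in> carr (oS X)" using im[OF Z] by (rule imageE)
      then show ?thesis using mr_\<alpha>[OF A(2)] e_d[OF fh(2)[OF A(2)]] hf by simp
    qed
  qed
qed

lemma Gamma'_bij: "bij_betw (Gamma' i) (Ir i) (End_cor i)"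
proof (rule bij_betw_byWitness[of _ "\<lambda>g. {s. g (tT 1 s) = tT s 1}"])
  show "\<forall>I\<in>Ir i. {s. Gamma' i I (tT 1 s) = tT s 1} = I"
    using Ir_coinvariant Gamma'_unit by blast
  show "\<forall>g\<in>End_cor i. Gamma' i {s. g (tT 1 s) = tT s 1} = g"
  proof
    fix g assume g: "g \<in> End_cor i"
    show "Gamma' i {s. g (tT 1 s) = tT s 1} = g"
      by (rule Gamma'_eqI[OF End_cor_Ir[OF g] End_corD(1-3)[OF g]]) simp
  qed
  show "Gamma' i ` Ir i \<subseteq> End_cor i" using Gamma'_End_cor by blast
  show "(\<lambda>g. {s. g (tT 1 s) = tT s 1}) ` End_cor i \<subseteq> Ir i" using End_cor_Ir by blast
qed

end

theorem theorem3p6: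
  fixes i :: "'b::ring_1 \<Rightarrow> 's::ring_1"
  assumes "ring_hom' i"
    and "comonadic i"
  shows "bij_betw (Gamma' i) (Ir i) (End_cor i)
       \<and> (\<forall>I\<in>Ir i. \<forall>J\<in>Ir i. Gamma' i (subprod I J) = compose (carr (sweedler i)) (Gamma' i J) (Gamma' i I))
       \<and> Gamma' i (range i) = restrict id (carr (sweedler i))"
proof -
  interpret comonadic_ext i
    by unfold_locales (rule assms)+
  show ?thesis
    using Gamma'_bij Gamma'_subprod Gamma'_range by blast
qed

end
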